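(* Let $l\ge1$ and $k$ be integers with $k>l+1$, let $t\mapsto h(t)$ ($t\in\mathbb R$) be a continuous $\mathcal H_l$-valued function, and let $M>0$. The following are equivalent. (i) For every continuous function $u:\mathbb R\to\mathcal H_k$ with $\sup_{t\in\mathbb R}\|u(t)\|_k<\infty$: (a) the integrals $$y(t)=\int_{\mathbb R}h(s)\lozenge u(t-s)\,ds,\qquad t\in\mathbb R,$$ exist; and (b) $$\sup_{t\in\mathbb R}\left\|\int_{\mathbb R}h(s)\lozenge u(t-s)\,ds\right\|_k\le M\sup_{t\in\mathbb R}\|u(t)\|_k .$$ (ii) For every $g\in\mathcal H_k$ of norm less than or equal to $1$, $$\int_{\mathbb R}\|T_{h(t)}^*g\|_k\,dt\le M .$$
   Context: $\mathbb N=\{1,2,\ldots\}$. $\ell$ denotes the set of sequences $\alpha=(\alpha_1,\alpha_2,\ldots)$ of nonnegative integers indexed by $\mathbb N$ with $\alpha_j=0$ for all large $j$; $(2\mathbb N)^{k\alpha}=\prod_j(2j)^{k\alpha_j}$. $(H_\alpha)_{\alpha\in\ell}$ is the orthogonal basis of Hermite functions of the (complexified) white noise space. For $k\in\mathbb N$, $\mathcal H_k$ is the Hilbert space of formal series $f=\sum_{\alpha\in\ell}c_\alpha H_\alpha$, $c_\alpha\in\mathbb C$, with $\|f\|_k=\left(\sum_\alpha|c_\alpha|^2(2\mathbb N)^{-k\alpha}\right)^{1/2}<\infty$. The Wick product $\lozenge$ is determined bilinearly by $H_\alpha\lozenge H_\beta=H_{\alpha+\beta}$ (convolution of coefficients).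 For $k>l+1$ and $h\in\mathcal H_l$, $T_h:u\mapsto h\lozenge u$ is a bounded operator on $\mathcal H_k$ (Våge's inequality), and $T_h^*$ is its adjoint in $\mathcal H_k$. Continuity of vector-valued functions is with respect to the norm of the space. Integrals of continuous $\mathcal H_k$-valued functions over compact intervals are Riemann integrals, and an $\mathcal H_k$-valued integral over $\mathbb R$ is the norm limit of $\int_a^b$ as $a\to-\infty$, $b\to+\infty$, when it exists. *)

theory Defs
  imports "HOL-Analysis.Analysis" "HOL-Library.Poly_Mapping"
begin

text \<open>
  Finitely supported sequences of nonnegative integers. The library indexes from \<open>0\<close>, so the
  entry \<open>\<alpha>\<^sub>j\<close> of the mathematical text (\<open>j = 1, 2, \<dots>\<close>) is \<^term>\<open>Poly_Mapping.lookup \<alpha> (j - 1)\<close>.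
\<close>

type_synonym multi_index = "nat \<Rightarrow>\<^sub>0 nat"

text \<open>A formal series \<open>\<Sum>\<^sub>\<alpha> c\<^sub>\<alpha> H\<^sub>\<alpha>\<close> is represented by its coefficient family \<open>c\<close>.\<close>

type_synonym hseries = "multi_index \<Rightarrow> complex"

definition hermite :: "multi_index \<Rightarrow> hseries" where
  "hermite \<alpha> = (\<lambda>\<beta>. if \<beta> = \<alpha> then 1 else 0)"

text \<open>The weight \<open>(2\<nat>)\<^sup>k\<^sup>\<alpha>\<close>; because of the index shift the base \<open>2j\<close> reads \<open>2(j + 1)\<close>.\<close>

definition hweight :: "nat \<Rightarrow> multi_index \<Rightarrow> real" where
  "hweight k \<alpha> = (\<Prod>j\<in>Poly_Mapping.keys \<alpha>. (2 * real (j + 1)) ^ (k * Poly_Mapping.lookup \<alpha> j))"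

definition hspace :: "nat \<Rightarrow> hseries set" where
  "hspace k = {f. (\<lambda>\<alpha>. (cmod (f \<alpha>))\<^sup>2 / hweight k \<alpha>) summable_on UNIV}"

definition hnorm :: "nat \<Rightarrow> hseries \<Rightarrow> real" where
  "hnorm k f = sqrt (\<Sum>\<^sub>\<infinity>\<alpha>. (cmod (f \<alpha>))\<^sup>2 / hweight k \<alpha>)"

definition hinner :: "nat \<Rightarrow> hseries \<Rightarrow> hseries \<Rightarrow> complex" where
  "hinner k f g = (\<Sum>\<^sub>\<infinity>\<alpha>. f \<alpha> * cnj (g \<alpha>) / complex_of_real (hweight k \<alpha>))"

definition wick :: "hseries \<Rightarrow> hseries \<Rightarrow> hseries" (infixl \<open>\<lozenge>\<close> 70) where
  "f \<lozenge> g = (\<lambda>\<alpha>. \<Sum>(\<beta>, \<gamma>)\<in>{(\<beta>, \<gamma>). \<beta> + \<gamma> = \<alpha>}. f \<beta> * g \<gamma>)"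

text \<open>The index set of the convolution sum is finite, so no summand is lost.\<close>

lemma finite_multi_index_decompositions:
  "finite {(\<beta>, \<gamma>). \<beta> + \<gamma> = (\<alpha> :: multi_index)}"
proof -
  let ?F = "{f. \<forall>x. (x \<in> Poly_Mapping.keys \<alpha> \<longrightarrow> f x \<in> {..Max (insert 0 (Poly_Mapping.lookup \<alpha> ` Poly_Mapping.keys \<alpha>))}) \<and>
                    (x \<notin> Poly_Mapping.keys \<alpha> \<longrightarrow> f x = (0::nat))}"
  let ?B = "{\<beta>. \<exists>\<gamma>. \<beta> + \<gamma> = \<alpha>}"
  have fin: "finite ?F"
    by (rule finite_set_of_finite_funs) auto
  have "Poly_Mapping.lookup ` ?B \<subseteq> ?F"
  proof (clarsimp, intro conjI impI)
    fix \<beta> \<gamma> :: multi_index and x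
    assume "x \<in> Poly_Mapping.keys (\<beta> + \<gamma>)"
    then have "Poly_Mapping.lookup (\<beta> + \<gamma>) x \<le> Max (insert 0 (Poly_Mapping.lookup (\<beta> + \<gamma>) ` Poly_Mapping.keys (\<beta> + \<gamma>)))"
      by (intro Max_ge) auto
    then show "Poly_Mapping.lookup \<beta> x \<le> Max (insert 0 (Poly_Mapping.lookup (\<beta> + \<gamma>) ` Poly_Mapping.keys (\<beta> + \<gamma>)))"
      by (simp add: lookup_add)
  next
    fix \<beta> \<gamma> :: multi_index and x
    assume "x \<notin> Poly_Mapping.keys (\<beta> + \<gamma>)"
    then show "Poly_Mapping.lookup \<beta> x = 0"
      by (simp add: in_keys_iff lookup_add)
  qed
  then have "finite (Poly_Mapping.lookup ` ?B)"
    using fin finite_subset by blast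
  then have B: "finite ?B"
    by (rule finite_imageD) (simp add: inj_on_def)
  have "{(\<beta>, \<gamma>). \<beta> + \<gamma> = \<alpha>} \<subseteq> ?B \<times> ?B"
    using add.commute by blast
  then show ?thesis
    using B finite_subset by blast
qed

lemma wick_hermite: "hermite \<alpha> \<lozenge> hermite \<beta> = hermite (\<alpha> + \<beta>)"
proof
  fix \<gamma>
  have "(hermite \<alpha> \<lozenge> hermite \<beta>) \<gamma> =
      (\<Sum>p\<in>{(\<beta>', \<gamma>'). \<beta>' + \<gamma>' = \<gamma>}. if p = (\<alpha>, \<beta>) then 1 else 0)"
    unfolding wick_def hermite_def by (intro sum.cong) (auto split: if_splits)
  also have "\<dots> = hermite (\<alpha> + \<beta>) \<gamma>"
    using finite_multi_index_decompositions[of \<gamma>] by (auto simp: hermite_def sum.delta)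
  finally show "(hermite \<alpha> \<lozenge> hermite \<beta>) \<gamma> = hermite (\<alpha> + \<beta>) \<gamma>" .
qed

text \<open>
  Adjoint in \<^term>\<open>hspace k\<close>. The vector on the right is unique, and it exists whenever
  \<open>T\<close> is a bounded operator on \<^term>\<open>hspace k\<close>.
\<close>

definition hadjoint :: "nat \<Rightarrow> (hseries \<Rightarrow> hseries) \<Rightarrow> hseries \<Rightarrow> hseries" where
  "hadjoint k T g =
     (THE v. v \<in> hspace k \<and> (\<forall>u\<in>hspace k. hinner k (T u) g = hinner k u v))"

definition hcontinuous :: "nat \<Rightarrow> (real \<Rightarrow> hseries) \<Rightarrow> bool" where
  "hcontinuous k u \<longleftrightarrow>
     (\<forall>t. u t \<in> hspace k) \<and> (\<forall>t. ((\<lambda>s. hnorm k (u s - u t)) \<longlongrightarrow> 0) (at t))"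

text \<open>
  Riemann integral: one mesh size \<open>\<delta>\<close> serves for all tags. Membership in \<^term>\<open>hspace k\<close> is
  required explicitly because \<^term>\<open>hnorm k\<close> carries no information outside this space.
\<close>

definition has_hintegral ::
  "nat \<Rightarrow> (real \<Rightarrow> hseries) \<Rightarrow> real \<Rightarrow> real \<Rightarrow> hseries \<Rightarrow> bool" where
  "has_hintegral k f a b I \<longleftrightarrow>
     (\<forall>s\<in>{a..b}. f s \<in> hspace k) \<and> I \<in> hspace k \<and>
     (\<forall>\<epsilon>>0. \<exists>\<delta>>0. \<forall>p. p tagged_division_of {a..b} \<and> (\<lambda>s. ball s \<delta>) fine p \<longrightarrow>
        hnorm k ((\<lambda>\<alpha>. \<Sum>(s, K)\<in>p. complex_of_real (measure lborel K) * f s \<alpha>) - I) < \<epsilon>)"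

definition has_hintegral_line :: "nat \<Rightarrow> (real \<Rightarrow> hseries) \<Rightarrow> hseries \<Rightarrow> bool" where
  "has_hintegral_line k f I \<longleftrightarrow> I \<in> hspace k \<and>
     (\<exists>J. (\<forall>a b. a \<le> b \<longrightarrow> has_hintegral k f a b (J a b)) \<and>
          ((\<lambda>(a, b). hnorm k (J a b - I)) \<longlongrightarrow> 0) (at_bot \<times>\<^sub>F at_top))"

definition hintegrable_line :: "nat \<Rightarrow> (real \<Rightarrow> hseries) \<Rightarrow> bool" where
  "hintegrable_line k f \<longleftrightarrow> (\<exists>I. has_hintegral_line k f I)"

definition hintegral_line :: "nat \<Rightarrow> (real \<Rightarrow> hseries) \<Rightarrow> hseries" where
  "hintegral_line k f = (THE I. has_hintegral_line k f I)"

end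

theory Submission
  imports Defs
begin

text \<open>
  Rescaling the coefficients by the square roots of the weights turns \<^term>\<open>hspace k\<close> into the
  space \<open>l\<^sup>2\<close> of square-summable families over the multi-indices. Since the weight of \<open>\<alpha> + \<beta>\<close> is the
  product of the weights of \<open>\<alpha>\<close> and \<open>\<beta>\<close>, Wick multiplication by \<open>h\<close> becomes ordinary convolution
  by the rescaled family of \<open>h\<close>, and Vage's inequality says that this family lies in \<open>l\<^sup>1\<close> when
  \<open>h \<in> \<H>\<^sub>l\<close> with \<open>k > l + 1\<close>. A convolution by an \<open>l\<^sup>1\<close> family is a norm-convergent series of shifts;
  its adjoint, a correlation, is the series of the adjoint shifts. All the continuity that is needed
  in \<open>t\<close> comes from the continuity of \<open>h\<close> in the \<open>l\<^sup>1\<close> norm of the rescaled family.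

  The equivalence itself is then a statement on operators \<open>T s\<close> with adjoints \<open>A s\<close> in a real
  Hilbert space (\<open>bounded_output_iff_adjoint_integrable\<close>), resting on
  \<open>\<langle>T s (u s), g\<rangle> = \<langle>u s, A s g\<rangle>\<close>.
  If \<open>\<integral> \<parallel>A s g\<parallel> ds \<le> M \<parallel>g\<parallel>\<close> for all \<open>g\<close>, then \<open>s \<mapsto> T s (u s)\<close> is absolutely integrable against
  every \<open>g\<close>, with integral at most \<open>M \<parallel>g\<parallel> sup \<parallel>u\<parallel>\<close>. The bound on the integral follows at once; its
  existence as a norm limit does not, and it uses the geometry of the Hilbert space: weak absolute
  integrability survives arbitrary changes of sign on disjoint intervals, whereas suitable signs
  make the squared norms of the blocks add up, so that the tails must be small
  (\<open>weakly_absolutely_integrable_tail\<close>). Conversely, taking for \<open>u s\<close> nearly the normalised vector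
  \<open>A s g\<close> turns the bound on the output, tested against \<open>g\<close>, into a bound on \<open>\<integral> \<parallel>A s g\<parallel> ds\<close>
  (\<open>integral_norm_le_by_duality\<close>).
\<close>

section \<open>The Hilbert space of square-summable complex families\<close>

definition square_summable :: "('i \<Rightarrow> complex) \<Rightarrow> bool" where
  "square_summable x \<longleftrightarrow> (\<lambda>i. (cmod (x i))\<^sup>2) summable_on UNIV"

lemma square_summable_add:
  assumes "square_summable x" "square_summable y"
  shows "square_summable (\<lambda>i. x i + y i)"
  unfolding square_summable_def
proof (rule summable_on_comparison_test[where f="\<lambda>i. 2 * (cmod (x i))\<^sup>2 + 2 * (cmod (y i))\<^sup>2"])
  show "(\<lambda>i. 2 * (cmod (x i))\<^sup>2 + 2 * (cmod (y i))\<^sup>2) summable_on UNIV"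
    using assms unfolding square_summable_def
    by (intro summable_on_add summable_on_cmult_right)
  fix i
  have "(cmod (x i + y i))\<^sup>2 \<le> (cmod (x i) + cmod (y i))\<^sup>2"
    by (intro power_mono norm_triangle_ineq) auto
  also have "\<dots> \<le> 2 * (cmod (x i))\<^sup>2 + 2 * (cmod (y i))\<^sup>2"
    using sum_squares_bound[of "cmod (x i)" "cmod (y i)"] by (simp add: power2_sum)
  finally show "(cmod (x i + y i))\<^sup>2 \<le> 2 * (cmod (x i))\<^sup>2 + 2 * (cmod (y i))\<^sup>2" .
qed auto

lemma square_summable_scale:
  assumes "square_summable x"
  shows "square_summable (\<lambda>i. c * x i)"
  using assms summable_on_cmult_right[of "\<lambda>i. (cmod (x i))\<^sup>2" UNIV "(cmod c)\<^sup>2"]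
  unfolding square_summable_def by (simp add: norm_mult power_mult_distrib)

lemma square_summable_zero: "square_summable (\<lambda>i. 0)"
  by (simp add: square_summable_def)

lemma square_summable_inner:
  assumes "square_summable x" "square_summable y"
  shows "(\<lambda>i. norm (x i \<bullet> y i)) summable_on UNIV"
proof (rule summable_on_comparison_test[where f="\<lambda>i. (cmod (x i))\<^sup>2 + (cmod (y i))\<^sup>2"])
  show "(\<lambda>i. (cmod (x i))\<^sup>2 + (cmod (y i))\<^sup>2) summable_on UNIV"
    using assms unfolding square_summable_def by (rule summable_on_add)
  fix i
  have "\<bar>x i \<bullet> y i\<bar> \<le> cmod (x i) * cmod (y i)" by (rule Cauchy_Schwarz_ineq2)
  also have "\<dots> \<le> (cmod (x i))\<^sup>2 + (cmod (y i))\<^sup>2"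
    using sum_squares_bound[of "cmod (x i)" "cmod (y i)"]
      mult_nonneg_nonneg[OF norm_ge_zero[of "x i"] norm_ge_zero[of "y i"]] by linarith
  finally show "norm (x i \<bullet> y i) \<le> (cmod (x i))\<^sup>2 + (cmod (y i))\<^sup>2" by simp
  show "0 \<le> norm (x i \<bullet> y i)" by simp
qed

text \<open>
  The families are complex, but the type is made a real Hilbert space, with the real part of the
  complex inner product: the norm is the same, and the theory of vector-valued integration is
  about real vector spaces.
\<close>

typedef 'i ell2 = "{x :: 'i \<Rightarrow> complex. square_summable x}"
  morphisms coeff Abs_ell2
  using square_summable_zero by blast

setup_lifting type_definition_ell2

lemma square_summable_coeff: "square_summable (coeff x)"
  using coeff by blast

lemma coeff_Abs_ell2: "square_summable x \<Longrightarrow> coeff (Abs_ell2 x) = x"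
  by (simp add: Abs_ell2_inverse)

lemma ell2_eqI: "(\<And>i. coeff x i = coeff y i) \<Longrightarrow> x = y"
  by (metis coeff_inject ext)

instantiation ell2 :: (type) real_vector
begin

lift_definition zero_ell2 :: "'a ell2" is "\<lambda>i. 0"
  by (rule square_summable_zero)

lift_definition plus_ell2 :: "'a ell2 \<Rightarrow> 'a ell2 \<Rightarrow> 'a ell2" is "\<lambda>x y i. x i + y i"
  by (rule square_summable_add)

lift_definition uminus_ell2 :: "'a ell2 \<Rightarrow> 'a ell2" is "\<lambda>x i. - x i"
  by (simp add: square_summable_def)

lift_definition scaleR_ell2 :: "real \<Rightarrow> 'a ell2 \<Rightarrow> 'a ell2" is "\<lambda>r x i. r *\<^sub>R x i"
  by (simp add: scaleR_conv_of_real square_summable_scale)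

definition minus_ell2 :: "'a ell2 \<Rightarrow> 'a ell2 \<Rightarrow> 'a ell2" where
  "minus_ell2 x y = x + - y"

instance
proof
  fix x y z :: "'a ell2" and r s :: real
  show "x + y + z = x + (y + z)" "x + y = y + x" "0 + x = x" "- x + x = 0"
    by (transfer; auto simp: algebra_simps)+
  show "x - y = x + - y" by (rule minus_ell2_def)
  show "r *\<^sub>R (x + y) = r *\<^sub>R x + r *\<^sub>R y" "(r + s) *\<^sub>R x = r *\<^sub>R x + s *\<^sub>R x"
    "r *\<^sub>R s *\<^sub>R x = (r * s) *\<^sub>R x" "1 *\<^sub>R x = x"
    by (transfer; auto simp: algebra_simps)+
qed

end

instantiation ell2 :: (type) real_inner
begin

definition inner_ell2 :: "'a ell2 \<Rightarrow> 'a ell2 \<Rightarrow> real" where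
  "inner_ell2 x y = (\<Sum>\<^sub>\<infinity>i. coeff x i \<bullet> coeff y i)"

definition norm_ell2 :: "'a ell2 \<Rightarrow> real" where
  "norm_ell2 x = sqrt (x \<bullet> x)"

definition sgn_ell2 :: "'a ell2 \<Rightarrow> 'a ell2" where
  "sgn_ell2 x = x /\<^sub>R norm x"

definition dist_ell2 :: "'a ell2 \<Rightarrow> 'a ell2 \<Rightarrow> real" where
  "dist_ell2 x y = norm (x - y)"

definition uniformity_ell2 :: "('a ell2 \<times> 'a ell2) filter" where
  "uniformity_ell2 = (INF e\<in>{0<..}. principal {(x, y). dist x y < e})"

definition open_ell2 :: "'a ell2 set \<Rightarrow> bool" where
  "open_ell2 S = (\<forall>x\<in>S. \<forall>\<^sub>F (x', y) in uniformity. x' = x \<longrightarrow> y \<in> S)"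

instance
proof
  fix x y z :: "'a ell2" and r :: real and S :: "'a ell2 set"
  have sq: "(\<lambda>i. coeff u i \<bullet> coeff v i) summable_on UNIV" for u v :: "'a ell2"
    by (rule abs_summable_summable[OF square_summable_inner[OF square_summable_coeff square_summable_coeff]])
  show "sgn x = x /\<^sub>R norm x" by (rule sgn_ell2_def)
  show "dist x y = norm (x - y)" by (rule dist_ell2_def)
  show "uniformity = (INF e\<in>{0<..}. principal {(x, y). dist (x::'a ell2) y < e})"
    by (rule uniformity_ell2_def)
  show "open S = (\<forall>x\<in>S. \<forall>\<^sub>F (x', y) in uniformity. x' = x \<longrightarrow> y \<in> S)"
    by (rule open_ell2_def)
  show "x \<bullet> y = y \<bullet> x" by (simp add: inner_ell2_def inner_commute)
  show "(x + y) \<bullet> z = x \<bullet> z + y \<bullet> z"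
    using sq by (simp add: inner_ell2_def plus_ell2.rep_eq inner_add_left infsum_add)
  show "r *\<^sub>R x \<bullet> y = r * (x \<bullet> y)"
    by (simp add: inner_ell2_def scaleR_ell2.rep_eq infsum_cmult_right')
  show ge: "0 \<le> x \<bullet> x" by (simp add: inner_ell2_def infsum_nonneg)
  show "(x \<bullet> x = 0) = (x = 0)"
  proof
    assume "x \<bullet> x = 0"
    then have "coeff x i \<bullet> coeff x i = 0" for i
      using nonneg_infsum_le_0D[of "\<lambda>i. coeff x i \<bullet> coeff x i" UNIV i] sq[of x x]
      by (simp add: inner_ell2_def)
    then show "x = 0" by (intro ell2_eqI) (simp add: zero_ell2.rep_eq)
  qed (simp add: inner_ell2_def zero_ell2.rep_eq)
  show "norm x = sqrt (x \<bullet> x)" by (rule norm_ell2_def)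
qed

end

lemma coeff_minus: "coeff (x - y) i = coeff x i - coeff y i"
  unfolding minus_ell2_def plus_ell2.rep_eq uminus_ell2.rep_eq by simp

lemma coeff_sum: "coeff (\<Sum>a\<in>A. f a) i = (\<Sum>a\<in>A. coeff (f a) i)"
  by (induction A rule: infinite_finite_induct) (auto simp: zero_ell2.rep_eq plus_ell2.rep_eq)

lemma has_sum_norm_ell2: "((\<lambda>i. (cmod (coeff x i))\<^sup>2) has_sum (norm x)\<^sup>2) UNIV"
  using square_summable_coeff[of x]
  by (simp add: square_summable_def power2_norm_eq_inner inner_ell2_def)

lemma has_sum_inner_ell2: "((\<lambda>i. coeff x i \<bullet> coeff y i) has_sum (x \<bullet> y)) UNIV"
  unfolding inner_ell2_def
  by (rule has_sum_infsum[OF abs_summable_summable[OF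
        square_summable_inner[OF square_summable_coeff square_summable_coeff]]])

lemma norm_coeff_le: "cmod (coeff x i) \<le> norm x"
proof -
  have "(\<Sum>j\<in>{i}. (cmod (coeff x j))\<^sup>2) \<le> (norm x)\<^sup>2"
    by (rule finite_sum_le_has_sum[OF has_sum_norm_ell2]) auto
  then show ?thesis by (auto intro: power2_le_imp_le)
qed

lemma bounded_linear_coeff: "bounded_linear (\<lambda>x. coeff x i)"
  by (rule bounded_linear_intro[where K=1])
    (auto simp: plus_ell2.rep_eq scaleR_ell2.rep_eq norm_coeff_le)

lemma square_summable_bound:
  assumes "\<And>F. finite F \<Longrightarrow> (\<Sum>i\<in>F. (cmod (x i))\<^sup>2) \<le> B"
  shows "square_summable x"
  unfolding square_summable_def
  by (intro nonneg_bdd_above_summable_on bdd_aboveI2[where M=B]) (auto simp: assms)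

lemma norm_ell2_le:
  assumes "\<And>F. finite F \<Longrightarrow> (\<Sum>i\<in>F. (cmod (coeff x i))\<^sup>2) \<le> B\<^sup>2" "B \<ge> 0"
  shows "norm x \<le> B"
  using has_sum_le_finite_sums[OF has_sum_norm_ell2[of x] assms(1)] assms(2)
  by (auto intro: power2_le_imp_le)

instance ell2 :: (type) banach
proof
  fix X :: "nat \<Rightarrow> 'a ell2" assume X: "Cauchy X"
  have "Cauchy (\<lambda>n. coeff (X n) i)" for i
    using bounded_linear.Cauchy[OF bounded_linear_coeff X] .
  then have "\<forall>i. \<exists>l. (\<lambda>n. coeff (X n) i) \<longlonglongrightarrow> l"
    by (simp add: Cauchy_convergent_iff convergent_def)
  then obtain L where L: "\<And>i. (\<lambda>n. coeff (X n) i) \<longlonglongrightarrow> L i" by metis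
  \<comment> \<open>Finite partial sums pass to the coordinatewise limit in the second index of the Cauchy
    condition.\<close>
  have tail: "(\<Sum>i\<in>F. (cmod (coeff (X m) i - L i))\<^sup>2) \<le> e\<^sup>2"
    if "finite F" "m \<ge> N" and C: "\<And>m n. m \<ge> N \<Longrightarrow> n \<ge> N \<Longrightarrow> norm (X m - X n) < e" for F m N e
  proof (rule LIMSEQ_le_const2)
    show "(\<lambda>n. \<Sum>i\<in>F. (cmod (coeff (X m) i - coeff (X n) i))\<^sup>2)
        \<longlonglongrightarrow> (\<Sum>i\<in>F. (cmod (coeff (X m) i - L i))\<^sup>2)"
      by (intro tendsto_intros L)
    have "(\<Sum>i\<in>F. (cmod (coeff (X m) i - coeff (X n) i))\<^sup>2) \<le> e\<^sup>2" if "n \<ge> N" for n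
    proof -
      have "(\<Sum>i\<in>F. (cmod (coeff (X m) i - coeff (X n) i))\<^sup>2)
          = (\<Sum>i\<in>F. (cmod (coeff (X m - X n) i))\<^sup>2)" by (simp add: coeff_minus)
      also have "\<dots> \<le> (norm (X m - X n))\<^sup>2"
        by (rule finite_sum_le_has_sum[OF has_sum_norm_ell2]) (auto simp: \<open>finite F\<close>)
      also have "\<dots> \<le> e\<^sup>2"
        using less_imp_le[OF C[OF \<open>m \<ge> N\<close> that]] by (intro power_mono) auto
      finally show ?thesis .
    qed
    then show "\<exists>N. \<forall>n\<ge>N. (\<Sum>i\<in>F. (cmod (coeff (X m) i - coeff (X n) i))\<^sup>2) \<le> e\<^sup>2" by blast
  qed
  obtain N1 where N1: "\<And>m n. m \<ge> N1 \<Longrightarrow> n \<ge> N1 \<Longrightarrow> norm (X m - X n) < 1"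
    using CauchyD[OF X, of 1] by auto
  have "square_summable (\<lambda>i. coeff (X N1) i - L i)"
    by (rule square_summable_bound[of _ "1\<^sup>2"]) (use tail[OF _ order_refl N1] in auto)
  from square_summable_add[OF square_summable_coeff[of "X N1"] square_summable_scale[OF this, of "-1"]]
  have LS: "square_summable L" by simp
  have "X \<longlonglongrightarrow> Abs_ell2 L"
  proof (rule LIMSEQ_I)
    fix r :: real assume "r > 0"
    then obtain N where N: "\<And>m n. m \<ge> N \<Longrightarrow> n \<ge> N \<Longrightarrow> norm (X m - X n) < r / 2"
      using CauchyD[OF X, of "r / 2"] by auto
    have "norm (X n - Abs_ell2 L) \<le> r / 2" if "n \<ge> N" for n
      using tail[OF _ that N] \<open>r > 0\<close>
      by (intro norm_ell2_le) (auto simp: coeff_minus coeff_Abs_ell2[OF LS])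
    then show "\<exists>no. \<forall>n\<ge>no. norm (X n - Abs_ell2 L) < r"
      using \<open>r > 0\<close> by (intro exI[of _ N]) fastforce
  qed
  then show "convergent X" by (auto simp: convergent_def)
qed

section \<open>Improper integrals of Hilbert-space-valued functions\<close>

definition has_improper_integral :: "(real \<Rightarrow> 'a::banach) \<Rightarrow> 'a \<Rightarrow> bool" where
  "has_improper_integral F L \<longleftrightarrow>
     ((\<lambda>(a, b). integral {a..b} F) \<longlongrightarrow> L) (at_bot \<times>\<^sub>F at_top)"

lemma continuous_integrable:
  fixes F :: "real \<Rightarrow> 'a::banach"
  assumes "continuous_on UNIV F"
  shows "F integrable_on {a..b}"
  using assms continuous_on_subset integrable_continuous_real by blast

lemma integral_inner_left:
  fixes F :: "real \<Rightarrow> 'a::{real_inner, banach}"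
  assumes "continuous_on UNIV F"
  shows "integral {a..b} F \<bullet> g = integral {a..b} (\<lambda>s. F s \<bullet> g)"
  using integral_linear[OF continuous_integrable[OF assms] bounded_linear_inner_left[of g]]
  by (simp add: o_def)

lemma abs_integral_inner_le:
  fixes F :: "real \<Rightarrow> 'a::{real_inner, banach}"
  assumes "continuous_on UNIV F"
  shows "\<bar>integral {a..b} F \<bullet> g\<bar> \<le> integral {a..b} (\<lambda>s. \<bar>F s \<bullet> g\<bar>)"
proof -
  have "norm (integral {a..b} (\<lambda>s. F s \<bullet> g)) \<le> integral {a..b} (\<lambda>s. \<bar>F s \<bullet> g\<bar>)"
    by (intro Henstock_Kurzweil_Integration.integral_norm_bound_integral
        continuous_integrable continuous_intros assms) auto
  then show ?thesis by (simp add: integral_inner_left[OF assms])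
qed

lemma norm_le_of_self_inner:
  fixes x :: "'a::real_inner"
  assumes "\<bar>x \<bullet> x\<bar> \<le> K * norm x" "K \<ge> 0"
  shows "norm x \<le> K"
proof (cases "x = 0")
  case False
  have "norm x * norm x \<le> K * norm x"
    using assms(1) by (simp add: dot_square_norm power2_eq_square)
  then show ?thesis using False by simp
qed (use assms in auto)

text \<open>
  A series (or improper integral) whose scalar images converge absolutely need not converge in
  norm in a general Banach space; in a Hilbert space it does. If the tails were not small there
  would be successive blocks \<open>x\<^sub>1, x\<^sub>2, \<dots>\<close> of norm above \<open>\<epsilon>\<close>. The sign of each new block can
  be chosen such that it makes a nonnegative inner product with the sum built so far, so that the
  squared norm of \<open>\<Sum>\<plusminus>x\<^sub>j\<close> grows by \<open>\<epsilon>\<^sup>2\<close> at each step; but the weak bound is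
  insensitive to signs and keeps this norm below \<open>K\<close>.
\<close>

lemma weakly_absolutely_integrable_tail:
  fixes F :: "real \<Rightarrow> 'a::{real_inner, banach}"
  assumes F: "continuous_on UNIV F"
    and weak: "\<And>g b. 0 \<le> b \<Longrightarrow> integral {0..b} (\<lambda>s. \<bar>F s \<bullet> g\<bar>) \<le> K * norm g"
    and "K \<ge> 0" "\<epsilon> > 0"
  shows "\<exists>R\<ge>0. \<forall>c d. R \<le> c \<and> c \<le> d \<longrightarrow> norm (integral {c..d} F) \<le> \<epsilon>"
proof (rule ccontr)
  assume "\<not> ?thesis"
  then have far: "\<exists>c d. R \<le> c \<and> c \<le> d \<and> norm (integral {c..d} F) > \<epsilon>" if "R \<ge> 0" for R
    using that by (meson not_le)
  have int: "(\<lambda>s. \<bar>F s \<bullet> g\<bar>) integrable_on {a..b}" for g a b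
    by (intro continuous_integrable continuous_intros F)
  have blocks: "\<exists>R\<ge>0. \<exists>x. real n * \<epsilon>\<^sup>2 \<le> (norm x)\<^sup>2 \<and>
      (\<forall>g. \<bar>x \<bullet> g\<bar> \<le> integral {0..R} (\<lambda>s. \<bar>F s \<bullet> g\<bar>))" for n :: nat
  proof (induction n)
    case 0
    show ?case by (intro exI[of _ 0] conjI exI[of _ "0::'a"]) auto
  next
    case (Suc n)
    then obtain R x where R: "R \<ge> 0" and x: "real n * \<epsilon>\<^sup>2 \<le> (norm x)\<^sup>2"
      and xg: "\<And>g. \<bar>x \<bullet> g\<bar> \<le> integral {0..R} (\<lambda>s. \<bar>F s \<bullet> g\<bar>)" by blast
    obtain c d where cd: "R \<le> c" "c \<le> d" and big: "norm (integral {c..d} F) > \<epsilon>"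
      using far[OF R] by blast
    define y where "y = (if x \<bullet> integral {c..d} F \<ge> 0 then integral {c..d} F else - integral {c..d} F)"
    have y: "norm y > \<epsilon>" "x \<bullet> y \<ge> 0" "\<And>g. \<bar>y \<bullet> g\<bar> = \<bar>integral {c..d} F \<bullet> g\<bar>"
      using big by (auto simp: y_def)
    have "(norm (x + y))\<^sup>2 = (norm x)\<^sup>2 + 2 * (x \<bullet> y) + (norm y)\<^sup>2"
      by (simp add: power2_norm_eq_inner inner_add_left inner_add_right inner_commute)
    moreover have "\<epsilon>\<^sup>2 \<le> (norm y)\<^sup>2" using y(1) \<open>\<epsilon> > 0\<close> by (intro power_mono) auto
    ultimately have "real (Suc n) * \<epsilon>\<^sup>2 \<le> (norm (x + y))\<^sup>2"
      using x y(2) by (simp add: algebra_simps)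
    moreover have "\<bar>(x + y) \<bullet> g\<bar> \<le> integral {0..d} (\<lambda>s. \<bar>F s \<bullet> g\<bar>)" for g
    proof -
      have "integral {R..c} (\<lambda>s. \<bar>F s \<bullet> g\<bar>) \<ge> 0"
        by (intro Henstock_Kurzweil_Integration.integral_nonneg int) auto
      moreover have "integral {0..R} (\<lambda>s. \<bar>F s \<bullet> g\<bar>) + integral {R..c} (\<lambda>s. \<bar>F s \<bullet> g\<bar>)
          = integral {0..c} (\<lambda>s. \<bar>F s \<bullet> g\<bar>)"
        using R cd by (intro Henstock_Kurzweil_Integration.integral_combine int) auto
      moreover have "integral {0..c} (\<lambda>s. \<bar>F s \<bullet> g\<bar>) + integral {c..d} (\<lambda>s. \<bar>F s \<bullet> g\<bar>)
          = integral {0..d} (\<lambda>s. \<bar>F s \<bullet> g\<bar>)"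
        using R cd by (intro Henstock_Kurzweil_Integration.integral_combine int) auto
      moreover have "\<bar>(x + y) \<bullet> g\<bar> \<le> \<bar>x \<bullet> g\<bar> + \<bar>y \<bullet> g\<bar>" by (simp add: inner_add_left)
      ultimately show ?thesis
        using xg[of g] y(3)[of g] abs_integral_inner_le[OF F, of c d g] by linarith
    qed
    moreover have "d \<ge> 0" using R cd by simp
    ultimately show ?case by blast
  qed
  have "real n * \<epsilon>\<^sup>2 \<le> K\<^sup>2" for n
  proof -
    obtain R x where R: "R \<ge> 0" and x: "real n * \<epsilon>\<^sup>2 \<le> (norm x)\<^sup>2"
      and xg: "\<And>g. \<bar>x \<bullet> g\<bar> \<le> integral {0..R} (\<lambda>s. \<bar>F s \<bullet> g\<bar>)" using blocks by blast
    have "norm x \<le> K"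
      using order_trans[OF xg[of x] weak[OF R]] \<open>K \<ge> 0\<close> by (rule norm_le_of_self_inner)
    then have "(norm x)\<^sup>2 \<le> K\<^sup>2" by (simp add: power_mono)
    with x show ?thesis by linarith
  qed
  moreover obtain n where "K\<^sup>2 < real n * \<epsilon>\<^sup>2"
    using reals_Archimedean3[of "\<epsilon>\<^sup>2"] \<open>\<epsilon> > 0\<close> by auto
  ultimately show False by (meson not_le)
qed

lemma weakly_absolutely_integrable_half_line:
  fixes F :: "real \<Rightarrow> 'a::{real_inner, banach}"
  assumes F: "continuous_on UNIV F"
    and weak: "\<And>g b. 0 \<le> b \<Longrightarrow> integral {0..b} (\<lambda>s. \<bar>F s \<bullet> g\<bar>) \<le> K * norm g"
    and "K \<ge> 0"
  shows "\<exists>L. ((\<lambda>b. integral {0..b} F) \<longlongrightarrow> L) at_top"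
proof -
  have diff: "norm (integral {0..d} F - integral {0..c} F) = norm (integral {c..d} F)"
    if "0 \<le> c" "c \<le> d" for c d
    using Henstock_Kurzweil_Integration.integral_combine[OF that continuous_integrable[OF F]]
    by (metis add_diff_cancel_left')
  have "Cauchy (\<lambda>n. integral {0..real n} F)"
  proof (rule CauchyI')
    fix e :: real assume "e > 0"
    then obtain R where R: "R \<ge> 0" "\<And>c d. R \<le> c \<Longrightarrow> c \<le> d \<Longrightarrow> norm (integral {c..d} F) \<le> e / 2"
      using weakly_absolutely_integrable_tail[OF assms, of "e / 2"] by auto
    obtain N where N: "R \<le> real N" using real_arch_simple by blast
    have "dist (integral {0..real m} F) (integral {0..real n} F) < e" if "m \<ge> N" "n > m" for m n
    proof -
      have "norm (integral {real m..real n} F) \<le> e / 2" using that N by (intro R) auto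
      then show ?thesis
        using diff[of "real m" "real n"] that \<open>e > 0\<close> by (simp add: dist_norm norm_minus_commute)
    qed
    then show "\<exists>M. \<forall>m\<ge>M. \<forall>n>m. dist (integral {0..real m} F) (integral {0..real n} F) < e"
      by blast
  qed
  then obtain L where L: "(\<lambda>n. integral {0..real n} F) \<longlonglongrightarrow> L"
    by (auto simp: Cauchy_convergent_iff convergent_def)
  have "((\<lambda>b. integral {0..b} F) \<longlongrightarrow> L) at_top"
    unfolding tendsto_iff eventually_at_top_linorder
  proof (intro allI impI)
    fix e :: real assume "e > 0"
    then obtain R where R: "R \<ge> 0" "\<And>c d. R \<le> c \<Longrightarrow> c \<le> d \<Longrightarrow> norm (integral {c..d} F) \<le> e / 2"
      using weakly_absolutely_integrable_tail[OF assms, of "e / 2"] by auto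
    have "dist (integral {0..b} F) L < e" if "b \<ge> R" for b
    proof -
      have "norm (L - integral {0..b} F) \<le> e / 2"
      proof (rule Lim_norm_ubound)
        show "(\<lambda>n. integral {0..real n} F - integral {0..b} F) \<longlonglongrightarrow> L - integral {0..b} F"
          by (intro tendsto_intros L)
        show "\<forall>\<^sub>F n in sequentially. norm (integral {0..real n} F - integral {0..b} F) \<le> e / 2"
          using eventually_ge_at_top[of "nat \<lceil>b\<rceil>"]
        proof eventually_elim
          case (elim n)
          then have "b \<le> real n" by linarith
          then show ?case using diff[of b "real n"] R that by auto
        qed
      qed simp
      then show ?thesis using \<open>e > 0\<close> by (simp add: dist_norm norm_minus_commute)
    qed
    then show "\<exists>N. \<forall>b\<ge>N. dist (integral {0..b} F) L < e" by blast
  qed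
  then show ?thesis by blast
qed

lemma eventually_bot_top_around:
  "\<forall>\<^sub>F (a, b) in at_bot \<times>\<^sub>F at_top. a \<le> (c::real) \<and> c \<le> (b::real)"
  unfolding case_prod_beta
  by (intro eventually_conj eventually_compose_filterlim[OF eventually_le_at_bot filterlim_fst]
      eventually_compose_filterlim[OF eventually_ge_at_top filterlim_snd])

lemma at_bot_prod_at_top_neq_bot [simp]:
  "(at_bot \<times>\<^sub>F at_top :: (real \<times> real) filter) \<noteq> bot"
  by (simp add: prod_filter_eq_bot)

lemma integral_reflect_half_line:
  fixes G :: "real \<Rightarrow> 'a::banach"
  shows "integral {0..b} (\<lambda>s. G (- s)) = integral {-b..0} G"
  using Henstock_Kurzweil_Integration.integral_reflect_real[where b=0 and a="-b" and f=G] by simp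

text \<open>
  The integral over a bounded interval, tested against itself, has norm at most \<open>K\<close>; this bound
  passes to the limit.
\<close>

lemma weakly_absolutely_integrable_improper:
  fixes F :: "real \<Rightarrow> 'a::{real_inner, banach}"
  assumes F: "continuous_on UNIV F"
    and weak: "\<And>g a b. a \<le> b \<Longrightarrow> integral {a..b} (\<lambda>s. \<bar>F s \<bullet> g\<bar>) \<le> K * norm g"
    and K: "K \<ge> 0"
  shows "\<exists>L. has_improper_integral F L \<and> norm L \<le> K"
proof -
  obtain L1 where L1: "((\<lambda>b. integral {0..b} F) \<longlongrightarrow> L1) at_top"
    using weakly_absolutely_integrable_half_line[OF F weak K] by blast
  have F': "continuous_on UNIV (\<lambda>s. F (- s))"
    by (intro continuous_on_compose2[OF F] continuous_intros) auto
  have "\<exists>L. ((\<lambda>b. integral {0..b} (\<lambda>s. F (- s))) \<longlongrightarrow> L) at_top"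
  proof (rule weakly_absolutely_integrable_half_line[OF F' _ K])
    fix g :: 'a and b :: real assume "0 \<le> b"
    then show "integral {0..b} (\<lambda>s. \<bar>F (- s) \<bullet> g\<bar>) \<le> K * norm g"
      unfolding integral_reflect_half_line[of b "\<lambda>s. \<bar>F s \<bullet> g\<bar>"] by (intro weak) simp
  qed
  then obtain L2 where L2: "((\<lambda>b. integral {-b..0} F) \<longlongrightarrow> L2) at_top"
    unfolding integral_reflect_half_line by blast
  have "((\<lambda>(a, b). integral {a..0} F + integral {0..b} F) \<longlongrightarrow> L2 + L1) (at_bot \<times>\<^sub>F at_top)"
    unfolding case_prod_beta
  proof (intro tendsto_add)
    show "((\<lambda>x. integral {0..snd x} F) \<longlongrightarrow> L1) (at_bot \<times>\<^sub>F at_top)"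
      by (rule filterlim_compose[OF L1 filterlim_snd])
    have "((\<lambda>a. integral {a..0} F) \<longlongrightarrow> L2) at_bot"
      using filterlim_compose[OF L2 filterlim_uminus_at_top_at_bot] by simp
    then show "((\<lambda>x. integral {fst x..0} F) \<longlongrightarrow> L2) (at_bot \<times>\<^sub>F at_top)"
      by (rule filterlim_compose[OF _ filterlim_fst])
  qed
  then have lim: "has_improper_integral F (L2 + L1)"
    unfolding has_improper_integral_def
  proof (rule Lim_transform_eventually)
    show "\<forall>\<^sub>F x in at_bot \<times>\<^sub>F at_top. (case x of (a, b) \<Rightarrow> integral {a..0} F + integral {0..b} F)
        = (case x of (a, b) \<Rightarrow> integral {a..b} F)"
      using eventually_bot_top_around[of 0]
      by eventually_elim
        (auto intro: Henstock_Kurzweil_Integration.integral_combine continuous_integrable[OF F])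
  qed
  have "norm (L2 + L1) \<le> K"
  proof (rule Lim_norm_ubound)
    show "((\<lambda>(a, b). integral {a..b} F) \<longlongrightarrow> L2 + L1) (at_bot \<times>\<^sub>F at_top)"
      using lim by (simp add: has_improper_integral_def)
    show "\<forall>\<^sub>F x in at_bot \<times>\<^sub>F at_top. norm (case x of (a, b) \<Rightarrow> integral {a..b} F) \<le> K"
      using eventually_bot_top_around[of 0]
    proof eventually_elim
      case (elim x)
      then have "\<bar>integral {fst x..snd x} F \<bullet> integral {fst x..snd x} F\<bar>
          \<le> K * norm (integral {fst x..snd x} F)"
        by (intro order_trans[OF abs_integral_inner_le[OF F] weak]) auto
      then show ?case using norm_le_of_self_inner K by (auto simp: case_prod_beta)
    qed
  qed simp
  with lim show ?thesis by blast
qed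

text \<open>
  The converse direction: testing against the normalised function \<open>u = v / (\<bar>v\<bar> + \<epsilon>)\<close>, which is
  continuous and stays in the unit ball even where \<open>v\<close> vanishes, recovers the integral of \<open>\<bar>v\<bar>\<close>
  up to \<open>\<epsilon>\<close> times the length of the interval, because \<open>r\<^sup>2 / (r + \<epsilon>) \<ge> r - \<epsilon>\<close>.
\<close>

lemma integral_norm_le_by_duality:
  fixes v :: "real \<Rightarrow> 'a::{real_inner, banach}"
  assumes v: "continuous_on UNIV v"
    and dual: "\<And>u. continuous_on UNIV u \<Longrightarrow> (\<And>s. norm (u s) \<le> 1) \<Longrightarrow>
      \<exists>c\<le>M. has_improper_integral (\<lambda>s. u s \<bullet> v s) c"
    and "a \<le> b"
  shows "integral {a..b} (\<lambda>s. norm (v s)) \<le> M"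
proof -
  have approx: "integral {a..b} (\<lambda>s. norm (v s)) - \<epsilon> * (b - a) \<le> M" if "\<epsilon> > 0" for \<epsilon>
  proof -
    define u where "u s = v s /\<^sub>R (norm (v s) + \<epsilon>)" for s
    have pos: "norm (v s) + \<epsilon> > 0" for s using that by (simp add: add_nonneg_pos)
    have u: "continuous_on UNIV u"
      unfolding u_def using pos by (intro continuous_intros v) (metis less_irrefl)
    have "norm (u s) \<le> 1" for s
      using pos[of s] that by (simp add: u_def divide_simps)
    then obtain c where "c \<le> M" and c: "has_improper_integral (\<lambda>s. u s \<bullet> v s) c"
      using dual[OF u] by blast
    have uv: "u s \<bullet> v s = (norm (v s))\<^sup>2 / (norm (v s) + \<epsilon>)" for s
      by (simp add: u_def power2_norm_eq_inner divide_inverse)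
    have nonneg: "u s \<bullet> v s \<ge> 0" for s
      using pos[of s] by (simp add: uv)
    have int: "(\<lambda>s. u s \<bullet> v s) integrable_on {a..b}" for a b
      by (intro continuous_integrable continuous_intros u v)
    have "norm (v s) - \<epsilon> \<le> u s \<bullet> v s" for s
    proof -
      have "(norm (v s) - \<epsilon>) * (norm (v s) + \<epsilon>) \<le> (norm (v s))\<^sup>2"
        by (simp add: algebra_simps power2_eq_square)
      then show ?thesis using pos[of s] by (simp add: uv pos_le_divide_eq)
    qed
    then have "integral {a..b} (\<lambda>s. norm (v s) - \<epsilon>) \<le> integral {a..b} (\<lambda>s. u s \<bullet> v s)"
      by (intro Henstock_Kurzweil_Integration.integral_le int continuous_integrable continuous_intros v)
    also have "\<dots> \<le> c"
    proof (rule tendsto_lowerbound)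
      show "((\<lambda>(a, b). integral {a..b} (\<lambda>s. u s \<bullet> v s)) \<longlongrightarrow> c) (at_bot \<times>\<^sub>F at_top)"
        using c by (simp add: has_improper_integral_def)
      show "\<forall>\<^sub>F x in at_bot \<times>\<^sub>F at_top. integral {a..b} (\<lambda>s. u s \<bullet> v s)
          \<le> (case x of (a, b) \<Rightarrow> integral {a..b} (\<lambda>s. u s \<bullet> v s))"
        using eventually_bot_top_around[of a] eventually_bot_top_around[of b]
        by eventually_elim
          (auto intro!: integral_subset_le int nonneg)
    qed simp
    also have "integral {a..b} (\<lambda>s. norm (v s) - \<epsilon>) = integral {a..b} (\<lambda>s. norm (v s)) - \<epsilon> * (b - a)"
      using \<open>a \<le> b\<close>
      by (subst Henstock_Kurzweil_Integration.integral_diff)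
        (auto intro!: continuous_integrable continuous_intros v)
    finally show ?thesis using \<open>c \<le> M\<close> by linarith
  qed
  show ?thesis
  proof (rule field_le_epsilon)
    fix e :: real assume "e > 0"
    have "e / (b - a + 1) * (b - a) \<le> e"
      using \<open>e > 0\<close> \<open>a \<le> b\<close> by (simp add: divide_simps)
    moreover have "e / (b - a + 1) > 0" using \<open>e > 0\<close> \<open>a \<le> b\<close> by simp
    ultimately show "integral {a..b} (\<lambda>s. norm (v s)) \<le> M + e"
      using approx[of "e / (b - a + 1)"] by linarith
  qed
qed

lemma nn_integral_line_le_iff:
  fixes \<phi> :: "real \<Rightarrow> real"
  assumes \<phi>: "continuous_on UNIV \<phi>" and nonneg: "\<And>s. \<phi> s \<ge> 0" and "M \<ge> 0"
  shows "(\<integral>\<^sup>+s. ennreal (\<phi> s) \<partial>lborel) \<le> ennreal M \<longleftrightarrow> (\<forall>a b. a \<le> b \<longrightarrow> integral {a..b} \<phi> \<le> M)"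
proof -
  have meas[measurable]: "\<phi> \<in> borel_measurable borel"
    using \<phi> by (rule borel_measurable_continuous_onI)
  have interval: "(\<integral>\<^sup>+s. ennreal (\<phi> s) * indicator {a..b} s \<partial>lborel) = ennreal (integral {a..b} \<phi>)" for a b
    by (rule nn_integral_has_integral_lebesgue')
      (use nonneg continuous_integrable[OF \<phi>] in \<open>auto simp: integrable_integral\<close>)
  show ?thesis
  proof
    assume L: "(\<integral>\<^sup>+s. ennreal (\<phi> s) \<partial>lborel) \<le> ennreal M"
    have "ennreal (integral {a..b} \<phi>) \<le> ennreal M" for a b
    proof -
      have "(\<integral>\<^sup>+s. ennreal (\<phi> s) * indicator {a..b} s \<partial>lborel) \<le> (\<integral>\<^sup>+s. ennreal (\<phi> s) \<partial>lborel)"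
        by (intro nn_integral_mono) (auto simp: indicator_def)
      with L show ?thesis by (simp add: interval)
    qed
    then show "\<forall>a b. a \<le> b \<longrightarrow> integral {a..b} \<phi> \<le> M"
      using \<open>M \<ge> 0\<close> by (simp add: ennreal_le_iff)
  next
    assume R: "\<forall>a b. a \<le> b \<longrightarrow> integral {a..b} \<phi> \<le> M"
    let ?f = "\<lambda>n s. ennreal (\<phi> s) * indicator {- real n..real n} s"
    have "(SUP n. ?f n s) = ennreal (\<phi> s)" for s
    proof (rule antisym)
      show "(SUP n. ?f n s) \<le> ennreal (\<phi> s)"
        by (intro SUP_least) (auto simp: indicator_def)
      obtain n :: nat where "\<bar>s\<bar> \<le> real n" using real_arch_simple by blast
      then have "ennreal (\<phi> s) = ?f n s" by (auto simp: indicator_def)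
      also have "\<dots> \<le> (SUP n. ?f n s)" by (rule SUP_upper) simp
      finally show "ennreal (\<phi> s) \<le> (SUP n. ?f n s)" .
    qed
    then have "(\<integral>\<^sup>+s. ennreal (\<phi> s) \<partial>lborel) = (\<integral>\<^sup>+s. (SUP n. ?f n s) \<partial>lborel)" by simp
    also have "\<dots> = (SUP n. integral\<^sup>N lborel (?f n))"
      by (rule nn_integral_monotone_convergence_SUP)
        (auto simp: incseq_def le_fun_def indicator_def)
    also have "\<dots> \<le> ennreal M"
      by (intro SUP_least) (use R in \<open>simp add: interval ennreal_leI\<close>)
    finally show "(\<integral>\<^sup>+s. ennreal (\<phi> s) \<partial>lborel) \<le> ennreal M" .
  qed
qed

section \<open>Bounded input, bounded output, in an abstract Hilbert space\<close>

text \<open>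
  The input enters as \<open>u s\<close> rather than \<open>u (t - s)\<close>: continuous functions with a given bound are
  permuted by \<open>s \<mapsto> t - s\<close>, so one value of the output, over all inputs, carries the same
  information as all values.
\<close>

lemma bounded_output_iff_adjoint_integrable:
  fixes T A :: "real \<Rightarrow> 'a::{real_inner, banach} \<Rightarrow> 'a"
  assumes adj: "\<And>s x g. T s x \<bullet> g = x \<bullet> A s g"
    and T: "\<And>u. continuous_on UNIV u \<Longrightarrow> continuous_on UNIV (\<lambda>s. T s (u s))"
    and A: "\<And>g. continuous_on UNIV (\<lambda>s. A s g)"
    and M: "M \<ge> 0"
  shows "(\<forall>u U. continuous_on UNIV u \<and> (\<forall>s. norm (u s) \<le> U) \<longrightarrow>
            (\<exists>y. has_improper_integral (\<lambda>s. T s (u s)) y \<and> norm y \<le> M * U)) \<longleftrightarrow>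
         (\<forall>g. norm g \<le> 1 \<longrightarrow> (\<integral>\<^sup>+s. ennreal (norm (A s g)) \<partial>lborel) \<le> ennreal M)"
    (is "?output \<longleftrightarrow> ?adjoint")
proof
  assume out: ?output
  show ?adjoint
  proof (intro allI impI)
    fix g :: 'a assume g: "norm g \<le> 1"
    have "integral {a..b} (\<lambda>s. norm (A s g)) \<le> M" if "a \<le> b" for a b
    proof (rule integral_norm_le_by_duality[OF A _ that])
      fix u :: "real \<Rightarrow> 'a" assume u: "continuous_on UNIV u" "\<And>s. norm (u s) \<le> 1"
      then obtain y where y: "has_improper_integral (\<lambda>s. T s (u s)) y" "norm y \<le> M * 1"
        using out by blast
      have "y \<bullet> g \<le> norm y * norm g" by (rule norm_cauchy_schwarz)
      also have "\<dots> \<le> M * 1" using y(2) g M by (intro mult_mono) auto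
      finally have "y \<bullet> g \<le> M" by simp
      moreover have "((\<lambda>x. (case x of (a, b) \<Rightarrow> integral {a..b} (\<lambda>s. T s (u s))) \<bullet> g)
          \<longlongrightarrow> y \<bullet> g) (at_bot \<times>\<^sub>F at_top)"
        using y(1) unfolding has_improper_integral_def by (intro tendsto_intros)
      then have "has_improper_integral (\<lambda>s. u s \<bullet> A s g) (y \<bullet> g)"
        unfolding has_improper_integral_def case_prod_beta
        by (simp add: integral_inner_left[OF T[OF u(1)]] adj)
      ultimately show "\<exists>c\<le>M. has_improper_integral (\<lambda>s. u s \<bullet> A s g) c" by blast
    qed
    then show "(\<integral>\<^sup>+s. ennreal (norm (A s g)) \<partial>lborel) \<le> ennreal M"
      by (subst nn_integral_line_le_iff) (auto intro!: continuous_intros A M)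
  qed
next
  assume adjoint: ?adjoint
  have scale: "A s (r *\<^sub>R g) = r *\<^sub>R A s g" for s r g
  proof -
    have "\<forall>x. x \<bullet> A s (r *\<^sub>R g) = x \<bullet> (r *\<^sub>R A s g)"
      by (metis adj inner_scaleR_right)
    then show ?thesis unfolding vector_eq_ldot .
  qed
  have int: "integral {a..b} (\<lambda>s. norm (A s g)) \<le> M * norm g" if "a \<le> b" for a b g
  proof -
    have "(\<integral>\<^sup>+s. ennreal (norm (A s (sgn g))) \<partial>lborel) \<le> ennreal M"
      using adjoint by (simp add: norm_sgn)
    then have "integral {a..b} (\<lambda>s. norm (A s (sgn g))) \<le> M"
      using that by (subst (asm) nn_integral_line_le_iff) (auto intro!: continuous_intros A M)
    then have "norm g * integral {a..b} (\<lambda>s. norm (A s (sgn g))) \<le> norm g * M"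
      by (intro mult_left_mono) auto
    also have "norm g * integral {a..b} (\<lambda>s. norm (A s (sgn g)))
        = integral {a..b} (\<lambda>s. norm (A s (norm g *\<^sub>R sgn g)))"
      by (simp add: scale)
    also have "norm g *\<^sub>R sgn g = g" by (cases "g = 0") (simp_all add: sgn_div_norm)
    finally show ?thesis by (simp add: mult.commute)
  qed
  show ?output
  proof (intro allI impI, elim conjE)
    fix u :: "real \<Rightarrow> 'a" and U
    assume u: "continuous_on UNIV u" and U: "\<forall>s. norm (u s) \<le> U"
    have "U \<ge> 0" using U norm_ge_zero order_trans by blast
    have "integral {a..b} (\<lambda>s. \<bar>T s (u s) \<bullet> g\<bar>) \<le> (M * U) * norm g" if "a \<le> b" for a b g
    proof -
      have "\<bar>T s (u s) \<bullet> g\<bar> \<le> U * norm (A s g)" for s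
        unfolding adj using U
        by (intro order_trans[OF Cauchy_Schwarz_ineq2] mult_right_mono) auto
      then have "integral {a..b} (\<lambda>s. \<bar>T s (u s) \<bullet> g\<bar>) \<le> integral {a..b} (\<lambda>s. U * norm (A s g))"
        by (intro Henstock_Kurzweil_Integration.integral_le continuous_integrable
            continuous_intros T u A)
      also have "\<dots> = U * integral {a..b} (\<lambda>s. norm (A s g))" by simp
      also have "\<dots> \<le> U * (M * norm g)"
        using int[OF that] \<open>U \<ge> 0\<close> by (intro mult_left_mono)
      finally show ?thesis by (simp add: mult_ac)
    qed
    then show "\<exists>y. has_improper_integral (\<lambda>s. T s (u s)) y \<and> norm y \<le> M * U"
      using M \<open>U \<ge> 0\<close> by (intro weakly_absolutely_integrable_improper T u) auto
  qed
qed

section \<open>Convolution by absolutely summable families\<close>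

text \<open>
  In a cancellative monoid \<open>\<alpha> - \<beta>\<close> is the inverse of addition only when \<open>\<alpha> = \<beta> + \<gamma>\<close> for some \<open>\<gamma>\<close>;
  other positions are left empty by the shift and get the value \<open>0\<close>. The two shifts, with their
  scalars, are adjoint to each other.
\<close>

definition shift_up :: "complex \<Rightarrow> 'i \<Rightarrow> 'i::cancel_comm_monoid_add ell2 \<Rightarrow> 'i ell2" where
  "shift_up c \<beta> x = Abs_ell2 (\<lambda>\<alpha>. if \<alpha> \<in> range ((+) \<beta>) then c * coeff x (\<alpha> - \<beta>) else 0)"

definition shift_down :: "complex \<Rightarrow> 'i \<Rightarrow> 'i::cancel_comm_monoid_add ell2 \<Rightarrow> 'i ell2" where
  "shift_down c \<beta> g = Abs_ell2 (\<lambda>\<gamma>. cnj c * coeff g (\<beta> + \<gamma>))"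

lemma inj_plus: "inj ((+) (\<beta>::'i::cancel_comm_monoid_add))"
  by (simp add: inj_def)

lemma has_sum_range_plus:
  fixes f :: "'i::cancel_comm_monoid_add \<Rightarrow> 'b::{topological_comm_monoid_add, t2_space}"
  assumes "\<And>\<alpha>. \<alpha> \<notin> range ((+) \<beta>) \<Longrightarrow> f \<alpha> = 0"
  shows "(f has_sum S) UNIV \<longleftrightarrow> ((\<lambda>\<gamma>. f (\<beta> + \<gamma>)) has_sum S) UNIV"
proof -
  have "(f has_sum S) UNIV \<longleftrightarrow> (f has_sum S) (range ((+) \<beta>))"
    by (rule has_sum_cong_neutral) (use assms in auto)
  also have "\<dots> \<longleftrightarrow> ((f \<circ> (+) \<beta>) has_sum S) UNIV"
    by (rule has_sum_reindex[OF inj_plus])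
  finally show ?thesis by (simp add: o_def)
qed

lemma shift_up_has_sum:
  fixes x :: "'i::cancel_comm_monoid_add ell2"
  shows "((\<lambda>\<alpha>. (cmod (if \<alpha> \<in> range ((+) \<beta>) then c * coeff x (\<alpha> - \<beta>) else 0))\<^sup>2)
    has_sum (cmod c * norm x)\<^sup>2) UNIV"
  by (subst has_sum_range_plus[where \<beta>=\<beta>])
    (auto simp: norm_mult power_mult_distrib intro!: has_sum_cmult_right has_sum_norm_ell2)

lemma coeff_shift_up:
  "coeff (shift_up c \<beta> x) \<alpha> = (if \<alpha> \<in> range ((+) \<beta>) then c * coeff x (\<alpha> - \<beta>) else 0)"
  unfolding shift_up_def
  by (subst coeff_Abs_ell2)
    (auto simp: square_summable_def intro!: has_sum_imp_summable[OF shift_up_has_sum])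

lemma norm_shift_up: "norm (shift_up c \<beta> x) = cmod c * norm x"
proof -
  have "(norm (shift_up c \<beta> x))\<^sup>2 = (cmod c * norm x)\<^sup>2"
    using has_sum_norm_ell2[of "shift_up c \<beta> x"] shift_up_has_sum[of \<beta> c x]
    unfolding coeff_shift_up by (rule has_sum_unique)
  then show ?thesis by (simp add: power2_eq_iff_nonneg)
qed

lemma shift_down_partial_sum:
  fixes g :: "'i::cancel_comm_monoid_add ell2"
  assumes "finite F"
  shows "(\<Sum>\<gamma>\<in>F. (cmod (cnj c * coeff g (\<beta> + \<gamma>)))\<^sup>2) \<le> (cmod c * norm g)\<^sup>2"
proof -
  have "(\<Sum>\<gamma>\<in>F. (cmod (coeff g (\<beta> + \<gamma>)))\<^sup>2) = (\<Sum>\<alpha>\<in>(+) \<beta> ` F. (cmod (coeff g \<alpha>))\<^sup>2)"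
    by (subst sum.reindex) (auto intro: inj_on_subset[OF inj_plus])
  also have "\<dots> \<le> (norm g)\<^sup>2"
    by (rule finite_sum_le_has_sum[OF has_sum_norm_ell2]) (use assms in auto)
  finally show ?thesis
    by (simp add: norm_mult power_mult_distrib mult_left_mono flip: sum_distrib_left)
qed

lemma coeff_shift_down: "coeff (shift_down c \<beta> g) \<gamma> = cnj c * coeff g (\<beta> + \<gamma>)"
  unfolding shift_down_def
  by (subst coeff_Abs_ell2) (auto intro: square_summable_bound[OF shift_down_partial_sum])

lemma norm_shift_down: "norm (shift_down c \<beta> g) \<le> cmod c * norm g"
  by (rule norm_ell2_le) (auto simp: coeff_shift_down shift_down_partial_sum)

lemma shift_adjoint: "shift_up c \<beta> x \<bullet> g = x \<bullet> shift_down c \<beta> g"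
proof -
  have "((\<lambda>\<alpha>. coeff (shift_up c \<beta> x) \<alpha> \<bullet> coeff g \<alpha>) has_sum (x \<bullet> shift_down c \<beta> g)) UNIV"
  proof (subst has_sum_range_plus[where \<beta>=\<beta>])
    have "coeff (shift_up c \<beta> x) (\<beta> + \<gamma>) \<bullet> coeff g (\<beta> + \<gamma>)
        = coeff x \<gamma> \<bullet> coeff (shift_down c \<beta> g) \<gamma>" for \<gamma>
      by (simp add: coeff_shift_up coeff_shift_down inner_complex_def algebra_simps)
    then show "((\<lambda>\<gamma>. coeff (shift_up c \<beta> x) (\<beta> + \<gamma>) \<bullet> coeff g (\<beta> + \<gamma>))
        has_sum (x \<bullet> shift_down c \<beta> g)) UNIV"
      using has_sum_inner_ell2[of x "shift_down c \<beta> g"] by simp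
  qed (auto simp: coeff_shift_up)
  then show ?thesis using has_sum_inner_ell2 has_sum_unique by blast
qed

text \<open>
  As norm-convergent series of shifts, convolution and its adjoint inherit boundedness and
  adjointness from the shifts, term by term.
\<close>

definition convolve :: "('i \<Rightarrow> complex) \<Rightarrow> 'i::cancel_comm_monoid_add ell2 \<Rightarrow> 'i ell2" where
  "convolve a x = (\<Sum>\<^sub>\<infinity>\<beta>. shift_up (a \<beta>) \<beta> x)"

definition correlate :: "('i \<Rightarrow> complex) \<Rightarrow> 'i::cancel_comm_monoid_add ell2 \<Rightarrow> 'i ell2" where
  "correlate a g = (\<Sum>\<^sub>\<infinity>\<beta>. shift_down (a \<beta>) \<beta> g)"

definition abs_summable :: "('i \<Rightarrow> complex) \<Rightarrow> bool" where
  "abs_summable a \<longleftrightarrow> (\<lambda>\<beta>. cmod (a \<beta>)) summable_on UNIV"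

definition l1_norm :: "('i \<Rightarrow> complex) \<Rightarrow> real" where
  "l1_norm a = (\<Sum>\<^sub>\<infinity>\<beta>. cmod (a \<beta>))"

lemma has_sum_l1_norm: "abs_summable a \<Longrightarrow> ((\<lambda>\<beta>. cmod (a \<beta>)) has_sum l1_norm a) UNIV"
  by (simp add: abs_summable_def l1_norm_def)

lemma l1_norm_nonneg: "l1_norm a \<ge> 0"
  by (simp add: l1_norm_def infsum_nonneg)

lemma shifts_summable:
  fixes f :: "'i \<Rightarrow> 'b::banach" and x :: "'c::real_normed_vector"
  assumes a: "abs_summable a" and le: "\<And>\<beta>. norm (f \<beta>) \<le> cmod (a \<beta>) * norm x"
  shows "f summable_on UNIV" (is ?summable)
    and "norm (infsum f UNIV) \<le> l1_norm a * norm x" (is ?bound)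
proof -
  have s: "((\<lambda>\<beta>. cmod (a \<beta>) * norm x) has_sum (l1_norm a * norm x)) UNIV"
    by (rule has_sum_cmult_left[OF has_sum_l1_norm[OF a]])
  show ?summable
    by (rule abs_summable_summable,
        rule summable_on_comparison_test[OF has_sum_imp_summable[OF s] le]) simp
  then show ?bound by (intro norm_infsum_le[OF has_sum_infsum s le])
qed

lemma has_sum_convolve:
  "abs_summable a \<Longrightarrow> ((\<lambda>\<beta>. shift_up (a \<beta>) \<beta> x) has_sum convolve a x) UNIV"
  unfolding convolve_def
  by (rule has_sum_infsum, rule shifts_summable[where x=x]) (auto simp: norm_shift_up)

lemma norm_convolve_le: "abs_summable a \<Longrightarrow> norm (convolve a x) \<le> l1_norm a * norm x"
  unfolding convolve_def by (rule shifts_summable) (auto simp: norm_shift_up)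

lemma has_sum_correlate:
  "abs_summable a \<Longrightarrow> ((\<lambda>\<beta>. shift_down (a \<beta>) \<beta> x) has_sum correlate a x) UNIV"
  unfolding correlate_def
  by (rule has_sum_infsum, rule shifts_summable[where x=x]) (auto simp: norm_shift_down)

lemma norm_correlate_le: "abs_summable a \<Longrightarrow> norm (correlate a x) \<le> l1_norm a * norm x"
  unfolding correlate_def by (rule shifts_summable) (auto simp: norm_shift_down)

lemma convolve_adjoint:
  assumes "abs_summable a"
  shows "convolve a x \<bullet> g = x \<bullet> correlate a g"
proof (rule has_sum_unique)
  show "((\<lambda>\<beta>. shift_up (a \<beta>) \<beta> x \<bullet> g) has_sum (convolve a x \<bullet> g)) UNIV"
    by (rule has_sum_bounded_linear[OF bounded_linear_inner_left has_sum_convolve[OF assms]])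
  show "((\<lambda>\<beta>. shift_up (a \<beta>) \<beta> x \<bullet> g) has_sum (x \<bullet> correlate a g)) UNIV"
    unfolding shift_adjoint
    by (rule has_sum_bounded_linear[OF bounded_linear_inner_right has_sum_correlate[OF assms]])
qed

lemma abs_summable_minus:
  assumes "abs_summable a" "abs_summable b"
  shows "abs_summable (\<lambda>\<beta>. a \<beta> - b \<beta>)"
  unfolding abs_summable_def
proof (rule summable_on_comparison_test)
  show "(\<lambda>\<beta>. cmod (a \<beta>) + cmod (b \<beta>)) summable_on UNIV"
    using assms unfolding abs_summable_def by (rule summable_on_add)
qed (auto intro: norm_triangle_ineq4)

lemma has_sum_diff_normed:
  fixes f g :: "'i \<Rightarrow> 'b::real_normed_vector"
  assumes "(f has_sum a) A" "(g has_sum b) A"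
  shows "((\<lambda>i. f i - g i) has_sum (a - b)) A"
  using has_sum_add[OF assms(1)
      has_sum_bounded_linear[OF bounded_linear_minus[OF bounded_linear_ident] assms(2)]]
  by simp

text \<open>
  Splitting the difference into a change of the kernel and a change of the argument gives the
  joint continuity of the convolution in both.
\<close>

lemma convolve_diff:
  assumes "abs_summable a" "abs_summable b"
  shows "convolve a x - convolve b y = convolve (\<lambda>\<beta>. a \<beta> - b \<beta>) x + convolve b (x - y)"
proof (rule has_sum_unique)
  have eq: "shift_up (a \<beta>) \<beta> x - shift_up (b \<beta>) \<beta> y
      = shift_up (a \<beta> - b \<beta>) \<beta> x + shift_up (b \<beta>) \<beta> (x - y)" for \<beta>
    by (rule ell2_eqI) (auto simp: coeff_shift_up coeff_minus plus_ell2.rep_eq algebra_simps)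
  show "((\<lambda>\<beta>. shift_up (a \<beta>) \<beta> x - shift_up (b \<beta>) \<beta> y) has_sum (convolve a x - convolve b y)) UNIV"
    by (intro has_sum_diff_normed has_sum_convolve assms)
  show "((\<lambda>\<beta>. shift_up (a \<beta>) \<beta> x - shift_up (b \<beta>) \<beta> y) has_sum
      (convolve (\<lambda>\<beta>. a \<beta> - b \<beta>) x + convolve b (x - y))) UNIV"
    unfolding eq
    by (intro has_sum_add has_sum_convolve abs_summable_minus assms)
qed

lemma correlate_diff:
  assumes "abs_summable a" "abs_summable b"
  shows "correlate a g - correlate b g = correlate (\<lambda>\<beta>. a \<beta> - b \<beta>) g"
proof (rule has_sum_unique)
  have eq: "shift_down (a \<beta>) \<beta> g - shift_down (b \<beta>) \<beta> g = shift_down (a \<beta> - b \<beta>) \<beta> g" for \<beta>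
    by (rule ell2_eqI) (auto simp: coeff_shift_down coeff_minus algebra_simps)
  show "((\<lambda>\<beta>. shift_down (a \<beta> - b \<beta>) \<beta> g) has_sum (correlate a g - correlate b g)) UNIV"
    unfolding eq[symmetric] by (intro has_sum_diff_normed has_sum_correlate assms)
  show "((\<lambda>\<beta>. shift_down (a \<beta> - b \<beta>) \<beta> g) has_sum correlate (\<lambda>\<beta>. a \<beta> - b \<beta>) g) UNIV"
    by (intro has_sum_correlate abs_summable_minus assms)
qed

lemma continuous_on_convolve:
  fixes u :: "real \<Rightarrow> 'i::cancel_comm_monoid_add ell2"
  assumes a: "\<And>s. abs_summable (a s)"
    and lim: "\<And>t. ((\<lambda>s. l1_norm (\<lambda>\<beta>. a s \<beta> - a t \<beta>)) \<longlongrightarrow> 0) (at t)"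
    and u: "continuous_on UNIV u"
  shows "continuous_on UNIV (\<lambda>s. convolve (a s) (u s))"
proof (simp add: continuous_on_eq_continuous_at continuous_at, intro allI)
  fix t
  have ut: "(u \<longlongrightarrow> u t) (at t)" using u by (simp add: continuous_on_eq_continuous_at continuous_at)
  have bound: "norm (convolve (a s) (u s) - convolve (a t) (u t))
      \<le> l1_norm (\<lambda>\<beta>. a s \<beta> - a t \<beta>) * norm (u s) + l1_norm (a t) * norm (u s - u t)" for s
    unfolding convolve_diff[OF a a]
    by (intro norm_triangle_mono norm_convolve_le a abs_summable_minus)
  have "((\<lambda>s. l1_norm (\<lambda>\<beta>. a s \<beta> - a t \<beta>) * norm (u s) + l1_norm (a t) * norm (u s - u t)) \<longlongrightarrow>
      0 * norm (u t) + l1_norm (a t) * norm (u t - u t)) (at t)"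
    by (intro tendsto_intros lim ut)
  then have "((\<lambda>s. convolve (a s) (u s) - convolve (a t) (u t)) \<longlongrightarrow> 0) (at t)"
    by (intro Lim_null_comparison[OF always_eventually, OF allI, OF bound]) simp
  then show "((\<lambda>s. convolve (a s) (u s)) \<longlongrightarrow> convolve (a t) (u t)) (at t)"
    by (simp add: LIM_zero_iff)
qed

lemma continuous_on_correlate:
  fixes g :: "'i::cancel_comm_monoid_add ell2"
  assumes a: "\<And>s::real. abs_summable (a s)"
    and lim: "\<And>t. ((\<lambda>s. l1_norm (\<lambda>\<beta>. a s \<beta> - a t \<beta>)) \<longlongrightarrow> 0) (at t)"
  shows "continuous_on UNIV (\<lambda>s. correlate (a s) g)"
proof (simp add: continuous_on_eq_continuous_at continuous_at, intro allI)
  fix t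
  have bound: "norm (correlate (a s) g - correlate (a t) g) \<le> l1_norm (\<lambda>\<beta>. a s \<beta> - a t \<beta>) * norm g" for s
    by (simp add: correlate_diff a norm_correlate_le abs_summable_minus)
  have "((\<lambda>s. l1_norm (\<lambda>\<beta>. a s \<beta> - a t \<beta>) * norm g) \<longlongrightarrow> 0) (at t)"
    using tendsto_mult[OF lim tendsto_const] by simp
  then have "((\<lambda>s. correlate (a s) g - correlate (a t) g) \<longlongrightarrow> 0) (at t)"
    by (rule Lim_null_comparison[OF always_eventually, OF allI, OF bound])
  then show "((\<lambda>s. correlate (a s) g) \<longlongrightarrow> correlate (a t) g) (at t)"
    by (simp add: LIM_zero_iff)
qed

section \<open>The weights and Vage's inequality\<close>

lemma hweight_superset:
  assumes "finite J" "Poly_Mapping.keys \<alpha> \<subseteq> J"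
  shows "hweight k \<alpha> = (\<Prod>j\<in>J. (2 * real (j + 1)) ^ (k * Poly_Mapping.lookup \<alpha> j))"
  unfolding hweight_def using assms
  by (intro prod.mono_neutral_left) (auto simp: in_keys_iff)

lemma hweight_pos: "hweight k \<alpha> > 0"
  unfolding hweight_def by (intro prod_pos) auto

lemma hweight_add: "hweight k (\<alpha> + \<beta>) = hweight k \<alpha> * hweight k \<beta>"
proof -
  let ?J = "Poly_Mapping.keys \<alpha> \<union> Poly_Mapping.keys \<beta>"
  have "Poly_Mapping.keys (\<alpha> + \<beta>) \<subseteq> ?J" by (auto simp: in_keys_iff lookup_add)
  then show ?thesis
    by (simp add: hweight_superset[of ?J] lookup_add distrib_left power_add prod.distrib)
qed

lemma hweight_add_exponent: "hweight (k + m) \<alpha> = hweight k \<alpha> * hweight m \<alpha>"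
  by (simp add: hweight_def distrib_right power_add prod.distrib)

text \<open>
  Every finite set of multi-indices lies in a box \<open>{0..N}\<^sup>J\<close> with \<open>J\<close> finite. Over the box the sum
  factors into geometric sums of ratio \<open>q\<^sub>j = (2(j+1))\<^sup>-\<^sup>m\<close>, each at most \<open>1 + 4 q\<^sub>j\<close> because
  \<open>q\<^sub>j \<le> 1/4\<close>. The product of these factors is controlled by \<open>\<Sum>q\<^sub>j\<close>, which converges since
  \<open>m \<ge> 2\<close>.
\<close>

lemma sum_inverse_hweight_bounded:
  assumes "m \<ge> 2" "finite F"
  shows "(\<Sum>\<alpha>\<in>F. 1 / hweight m \<alpha>) \<le> exp (suminf (\<lambda>j. inverse ((real (Suc j))\<^sup>2)))"
proof -
  define J where "J = (\<Union>\<alpha>\<in>F. Poly_Mapping.keys \<alpha>)"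
  define N where "N = Max (insert 0 ((\<lambda>(\<alpha>, j). Poly_Mapping.lookup \<alpha> j) ` (F \<times> J)))"
  define q where "q j = 1 / (2 * real (j + 1)) ^ m" for j
  have J: "finite J" using assms(2) by (simp add: J_def)
  have N: "Poly_Mapping.lookup \<alpha> j \<le> N" if "\<alpha> \<in> F" "j \<in> J" for \<alpha> j
    unfolding N_def using that assms(2) J by (intro Max_ge) auto
  have q0: "q j \<ge> 0" for j by (simp add: q_def)
  have q1: "q j \<le> inverse ((real (Suc j))\<^sup>2) / 4" for j
  proof -
    have "(2 * real (j + 1))\<^sup>2 \<le> (2 * real (j + 1)) ^ m"
      using assms(1) by (intro power_increasing) auto
    then have "q j \<le> 1 / (2 * real (j + 1))\<^sup>2"
      unfolding q_def by (intro divide_left_mono) auto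
    also have "\<dots> = inverse ((real (Suc j))\<^sup>2) / 4"
      by (simp add: divide_simps power2_eq_square) (simp add: algebra_simps)
    finally show ?thesis .
  qed
  have q2: "q j \<le> 1 / 4" for j
  proof -
    have "inverse ((real (Suc j))\<^sup>2) \<le> 1" by (intro inverse_le_1_iff[THEN iffD2]) auto
    then show ?thesis using q1[of j] by simp
  qed
  let ?\<phi> = "\<lambda>\<alpha>. restrict (Poly_Mapping.lookup \<alpha>) J"
  have inj: "inj_on ?\<phi> F"
  proof (rule inj_onI)
    fix \<alpha> \<beta> assume ab: "\<alpha> \<in> F" "\<beta> \<in> F" "?\<phi> \<alpha> = ?\<phi> \<beta>"
    show "\<alpha> = \<beta>"
    proof (rule poly_mapping_eqI)
      fix j show "Poly_Mapping.lookup \<alpha> j = Poly_Mapping.lookup \<beta> j"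
      proof (cases "j \<in> J")
        case True then show ?thesis using fun_cong[OF ab(3), of j] by simp
      next
        case False then show ?thesis using ab by (auto simp: J_def in_keys_iff)
      qed
    qed
  qed
  have "(\<Sum>\<alpha>\<in>F. 1 / hweight m \<alpha>) = (\<Sum>\<alpha>\<in>F. \<Prod>j\<in>J. q j ^ ?\<phi> \<alpha> j)"
  proof (rule sum.cong[OF refl])
    fix \<alpha> assume "\<alpha> \<in> F"
    then have "hweight m \<alpha> = (\<Prod>j\<in>J. (2 * real (j + 1)) ^ (m * Poly_Mapping.lookup \<alpha> j))"
      by (intro hweight_superset J) (auto simp: J_def)
    then show "1 / hweight m \<alpha> = (\<Prod>j\<in>J. q j ^ ?\<phi> \<alpha> j)"
      by (simp add: q_def power_mult power_divide prod_dividef)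
  qed
  also have "\<dots> = (\<Sum>p\<in>?\<phi> ` F. \<Prod>j\<in>J. q j ^ p j)"
    by (simp add: sum.reindex[OF inj])
  also have "\<dots> \<le> (\<Sum>p\<in>PiE J (\<lambda>_. {..N}). \<Prod>j\<in>J. q j ^ p j)"
    by (intro sum_mono2 finite_PiE J prod_nonneg) (use N q0 in \<open>auto simp: PiE_def\<close>)
  also have "\<dots> = (\<Prod>j\<in>J. \<Sum>i\<le>N. q j ^ i)"
    by (rule prod_sum_PiE[symmetric]) (use J in auto)
  also have "\<dots> \<le> (\<Prod>j\<in>J. exp (inverse ((real (Suc j))\<^sup>2)))"
  proof (intro prod_mono conjI sum_nonneg zero_le_power q0)
    fix j
    have "(\<Sum>i\<le>N. q j ^ i) = (1 - q j ^ Suc N) / (1 - q j)"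
      using q2[of j] by (simp add: sum_gp0)
    also have "\<dots> \<le> 1 / (1 - q j)"
      using q0[of j] q2[of j] by (intro divide_right_mono) auto
    also have "\<dots> \<le> 1 + 4 * q j"
    proof -
      have "q j * (4 * q j) \<le> q j * 3" using q0[of j] q2[of j] by (intro mult_left_mono) auto
      then have "1 \<le> (1 + 4 * q j) * (1 - q j)" by (simp add: algebra_simps)
      then show ?thesis using q2[of j] by (simp add: pos_divide_le_eq)
    qed
    also have "\<dots> \<le> 1 + inverse ((real (Suc j))\<^sup>2)" using q1[of j] by simp
    also have "\<dots> \<le> exp (inverse ((real (Suc j))\<^sup>2))" by (rule exp_ge_add_one_self)
    finally show "(\<Sum>i\<le>N. q j ^ i) \<le> exp (inverse ((real (Suc j))\<^sup>2))" .
  qed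
  also have "\<dots> = exp (\<Sum>j\<in>J. inverse ((real (Suc j))\<^sup>2))" by (simp add: exp_sum J)
  also have "\<dots> \<le> exp (suminf (\<lambda>j. inverse ((real (Suc j))\<^sup>2)))"
  proof -
    have "summable (\<lambda>j. inverse ((real (Suc j))\<^sup>2))"
      using inverse_power_summable[of 2, where 'a=real] by (subst summable_Suc_iff) auto
    then show ?thesis by (simp add: sum_le_suminf J)
  qed
  finally show ?thesis .
qed

lemma square_summable_inverse_hweight:
  assumes "m \<ge> 2"
  shows "square_summable (\<lambda>\<alpha>. 1 / complex_of_real (sqrt (hweight m \<alpha>)))"
  by (rule square_summable_bound[where B="exp (suminf (\<lambda>j. inverse ((real (Suc j))\<^sup>2)))"])
    (use sum_inverse_hweight_bounded[OF assms] hweight_pos[of m] in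
      \<open>simp add: norm_divide power_divide less_imp_le\<close>)

section \<open>The isometry of the weighted spaces with the unweighted one\<close>

definition embed :: "nat \<Rightarrow> hseries \<Rightarrow> multi_index ell2" where
  "embed k f = Abs_ell2 (\<lambda>\<alpha>. f \<alpha> / complex_of_real (sqrt (hweight k \<alpha>)))"

definition unembed :: "nat \<Rightarrow> multi_index ell2 \<Rightarrow> hseries" where
  "unembed k x = (\<lambda>\<alpha>. coeff x \<alpha> * complex_of_real (sqrt (hweight k \<alpha>)))"

lemma cmod_weighted: "(cmod (z / complex_of_real (sqrt (hweight k \<alpha>))))\<^sup>2 = (cmod z)\<^sup>2 / hweight k \<alpha>"
  using hweight_pos[of k \<alpha>] by (simp add: norm_divide power_divide less_imp_le)

lemma hspace_iff_square_summable:
  "f \<in> hspace k \<longleftrightarrow> square_summable (\<lambda>\<alpha>. f \<alpha> / complex_of_real (sqrt (hweight k \<alpha>)))"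
  unfolding hspace_def square_summable_def cmod_weighted by simp

lemma coeff_embed: "f \<in> hspace k \<Longrightarrow> coeff (embed k f) \<alpha> = f \<alpha> / complex_of_real (sqrt (hweight k \<alpha>))"
  by (simp add: embed_def coeff_Abs_ell2 hspace_iff_square_summable)

lemma embed_eqI:
  assumes "\<And>\<alpha>. f \<alpha> / complex_of_real (sqrt (hweight k \<alpha>)) = coeff x \<alpha>"
  shows "f \<in> hspace k" and "embed k f = x"
  using assms square_summable_coeff[of x]
  by (simp_all add: hspace_iff_square_summable embed_def coeff_inverse)

lemma unembed_in_hspace: "unembed k x \<in> hspace k"
  and embed_unembed: "embed k (unembed k x) = x"
  using hweight_pos by (auto intro!: embed_eqI simp: unembed_def less_imp_neq[symmetric])

lemma hnorm_eq_norm_embed: "f \<in> hspace k \<Longrightarrow> hnorm k f = norm (embed k f)"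
  using infsumI[OF has_sum_norm_ell2[of "embed k f"]]
  by (simp add: hnorm_def coeff_embed cmod_weighted)

lemma embed_inject: "f \<in> hspace k \<Longrightarrow> g \<in> hspace k \<Longrightarrow> embed k f = embed k g \<Longrightarrow> f = g"
proof
  fix \<alpha> assume "f \<in> hspace k" "g \<in> hspace k" "embed k f = embed k g"
  then have "f \<alpha> / complex_of_real (sqrt (hweight k \<alpha>)) = g \<alpha> / complex_of_real (sqrt (hweight k \<alpha>))"
    by (metis coeff_embed)
  then show "f \<alpha> = g \<alpha>" using hweight_pos[of k \<alpha>] by simp
qed

lemma hspace_diff: "f \<in> hspace k \<Longrightarrow> g \<in> hspace k \<Longrightarrow> f - g \<in> hspace k"
  and embed_diff: "f \<in> hspace k \<Longrightarrow> g \<in> hspace k \<Longrightarrow> embed k (f - g) = embed k f - embed k g"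
  by (rule embed_eqI[where x="embed k f - embed k g"];
      simp add: coeff_minus coeff_embed diff_divide_distrib)+

lemma hspace_real_combination:
  fixes c :: "'b \<Rightarrow> real"
  assumes "\<And>i. i \<in> A \<Longrightarrow> f i \<in> hspace k"
  shows "(\<lambda>\<alpha>. \<Sum>i\<in>A. complex_of_real (c i) * f i \<alpha>) \<in> hspace k"
    and "embed k (\<lambda>\<alpha>. \<Sum>i\<in>A. complex_of_real (c i) * f i \<alpha>) = (\<Sum>i\<in>A. c i *\<^sub>R embed k (f i))"
  by (rule embed_eqI[where x="\<Sum>i\<in>A. c i *\<^sub>R embed k (f i)"];
      simp add: coeff_sum scaleR_ell2.rep_eq coeff_embed assms sum_divide_distrib scaleR_conv_of_real)+

lemma hcontinuous_iff:
  "hcontinuous k u \<longleftrightarrow> (\<forall>t. u t \<in> hspace k) \<and> continuous_on UNIV (\<lambda>t. embed k (u t))"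
proof (cases "\<forall>t. u t \<in> hspace k")
  case True
  then have "hnorm k (u s - u t) = norm (embed k (u s) - embed k (u t))" for s t
    by (simp add: hnorm_eq_norm_embed hspace_diff embed_diff)
  then show ?thesis using True
    by (simp add: hcontinuous_def continuous_on_eq_continuous_at continuous_at
        tendsto_norm_zero_iff LIM_zero_iff)
next
  case False
  then show ?thesis unfolding hcontinuous_def by blast
qed

text \<open>
  The coordinates of \<open>h\<close> in the orthonormal basis \<open>H\<^sub>\<alpha> / \<parallel>H\<^sub>\<alpha>\<parallel>\<^sub>k\<close> of \<^term>\<open>hspace k\<close>. They agree with
  those of \<open>embed k h\<close>, but here the family acts on \<open>l\<^sup>2\<close> by convolution and what matters is its
  \<open>l\<^sup>1\<close> norm.
\<close>

definition kernel :: "nat \<Rightarrow> hseries \<Rightarrow> multi_index \<Rightarrow> complex" where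
  "kernel k h = (\<lambda>\<alpha>. h \<alpha> / complex_of_real (sqrt (hweight k \<alpha>)))"

text \<open>
  This is Vage's inequality in disguise. The weight for \<open>k\<close> is the product of those for \<open>l\<close> and
  \<open>k - l\<close>, so the sum of the absolute values of the kernel is an inner product of the family of
  \<open>h\<close> rescaled for \<open>l\<close> with the inverse square roots of the weights for \<open>k - l \<ge> 2\<close>. The
  Cauchy--Schwarz inequality in \<open>l\<^sup>2\<close> bounds it.
\<close>

lemma kernel_l1_norm_le:
  assumes kl: "k > l + 1"
  shows "\<exists>C. \<forall>h\<in>hspace l. abs_summable (kernel k h) \<and> l1_norm (kernel k h) \<le> C * hnorm l h"
proof -
  define y where "y = Abs_ell2 (\<lambda>\<alpha>. 1 / complex_of_real (sqrt (hweight (k - l) \<alpha>)))"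
  have y: "coeff y \<alpha> = 1 / complex_of_real (sqrt (hweight (k - l) \<alpha>))" for \<alpha>
    using square_summable_inverse_hweight[of "k - l"] kl by (simp add: y_def coeff_Abs_ell2)
  have "abs_summable (kernel k h) \<and> l1_norm (kernel k h) \<le> norm y * hnorm l h" if h: "h \<in> hspace l" for h
  proof -
    have sq: "square_summable (\<lambda>\<alpha>. complex_of_real (cmod (coeff (embed l h) \<alpha>)))"
      using square_summable_coeff[of "embed l h"] by (simp add: square_summable_def)
    define x where "x = Abs_ell2 (\<lambda>\<alpha>. complex_of_real (cmod (coeff (embed l h) \<alpha>)))"
    have x: "coeff x \<alpha> = complex_of_real (cmod (coeff (embed l h) \<alpha>))" for \<alpha>
      by (simp add: x_def coeff_Abs_ell2 sq)
    have "(norm x)\<^sup>2 = (norm (embed l h))\<^sup>2"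
      by (rule has_sum_unique[OF has_sum_norm_ell2[of x]]) (simp add: x has_sum_norm_ell2)
    then have nx: "norm x = hnorm l h" by (simp add: hnorm_eq_norm_embed h)
    have "coeff x \<alpha> \<bullet> coeff y \<alpha> = cmod (kernel k h \<alpha>)" for \<alpha>
    proof -
      have "hweight k \<alpha> = hweight l \<alpha> * hweight (k - l) \<alpha>"
        using hweight_add_exponent[of l "k - l" \<alpha>] kl by simp
      then show ?thesis
        using hweight_pos[of l \<alpha>] hweight_pos[of "k - l" \<alpha>]
        by (simp add: x y kernel_def coeff_embed h inner_complex_def norm_divide norm_mult real_sqrt_mult less_imp_le
            Re_divide_of_real flip: of_real_divide)
    qed
    then have s: "((\<lambda>\<alpha>. cmod (kernel k h \<alpha>)) has_sum (x \<bullet> y)) UNIV"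
      using has_sum_inner_ell2[of x y] by simp
    then have "l1_norm (kernel k h) = x \<bullet> y" by (simp add: l1_norm_def infsumI)
    also have "\<dots> \<le> norm y * hnorm l h"
      using norm_cauchy_schwarz[of x y] by (simp add: nx mult.commute)
    finally show ?thesis using s by (auto simp: abs_summable_def has_sum_imp_summable)
  qed
  then show ?thesis by blast
qed

lemma coeff_convolve:
  fixes x :: "multi_index ell2"
  assumes "abs_summable a"
  shows "coeff (convolve a x) \<alpha> = (\<Sum>(\<beta>, \<gamma>)\<in>{(\<beta>, \<gamma>). \<beta> + \<gamma> = \<alpha>}. a \<beta> * coeff x \<gamma>)"
proof (rule has_sum_unique)
  let ?D = "{(\<beta>, \<gamma>). \<beta> + \<gamma> = \<alpha>}"
  show "((\<lambda>\<beta>. coeff (shift_up (a \<beta>) \<beta> x) \<alpha>) has_sum coeff (convolve a x) \<alpha>) UNIV"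
    by (rule has_sum_bounded_linear[OF bounded_linear_coeff has_sum_convolve[OF assms]])
  have inj: "inj_on fst ?D" by (auto simp: inj_on_def)
  have "(\<Sum>(\<beta>, \<gamma>)\<in>?D. a \<beta> * coeff x \<gamma>) = (\<Sum>p\<in>?D. coeff (shift_up (a (fst p)) (fst p) x) \<alpha>)"
    by (intro sum.cong) (auto simp: coeff_shift_up)
  also have "\<dots> = (\<Sum>\<beta>\<in>fst ` ?D. coeff (shift_up (a \<beta>) \<beta> x) \<alpha>)"
    by (simp add: sum.reindex[OF inj])
  finally show "((\<lambda>\<beta>. coeff (shift_up (a \<beta>) \<beta> x) \<alpha>) has_sum
      (\<Sum>(\<beta>, \<gamma>)\<in>?D. a \<beta> * coeff x \<gamma>)) UNIV"
    by (intro has_sum_finite_neutralI[of "fst ` ?D"] finite_imageI finite_multi_index_decompositions)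
      (auto simp: coeff_shift_up image_iff)
qed

text \<open>
  The square roots of the weights are multiplicative in the index, so rescaling commutes with the
  convolution of coefficients.
\<close>

lemma wick_in_hspace_embed:
  assumes a: "abs_summable (kernel k h)" and u: "u \<in> hspace k"
  shows "h \<lozenge> u \<in> hspace k" and "embed k (h \<lozenge> u) = convolve (kernel k h) (embed k u)"
proof -
  have "(h \<lozenge> u) \<alpha> / complex_of_real (sqrt (hweight k \<alpha>))
      = coeff (convolve (kernel k h) (embed k u)) \<alpha>" for \<alpha>
    unfolding coeff_convolve[OF a] wick_def sum_divide_distrib
    by (intro sum.cong) (auto simp: kernel_def coeff_embed u hweight_add real_sqrt_mult)
  then show "h \<lozenge> u \<in> hspace k" "embed k (h \<lozenge> u) = convolve (kernel k h) (embed k u)"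
    by (rule embed_eqI)+
qed

lemma Re_hinner:
  assumes f: "f \<in> hspace k" and g: "g \<in> hspace k"
  shows "Re (hinner k f g) = embed k f \<bullet> embed k g"
proof -
  let ?x = "coeff (embed k f)" and ?y = "coeff (embed k g)"
  have summand: "f \<alpha> * cnj (g \<alpha>) / complex_of_real (hweight k \<alpha>) =
      complex_of_real (?x \<alpha> \<bullet> ?y \<alpha>) + \<i> * complex_of_real (?x \<alpha> \<bullet> (\<i> * ?y \<alpha>))" for \<alpha>
  proof -
    have "f \<alpha> * cnj (g \<alpha>) / complex_of_real (hweight k \<alpha>) = ?x \<alpha> * cnj (?y \<alpha>)"
      using hweight_pos[of k \<alpha>]
      by (simp add: coeff_embed f g less_imp_le flip: of_real_mult)
    also have "\<dots> = complex_of_real (?x \<alpha> \<bullet> ?y \<alpha>) + \<i> * complex_of_real (?x \<alpha> \<bullet> (\<i> * ?y \<alpha>))"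
      by (simp add: complex_eq_iff inner_complex_def algebra_simps)
    finally show ?thesis .
  qed
  define z where "z = Abs_ell2 (\<lambda>\<alpha>. \<i> * ?y \<alpha>)"
  have z: "coeff z \<alpha> = \<i> * ?y \<alpha>" for \<alpha>
    by (simp add: z_def coeff_Abs_ell2 square_summable_scale square_summable_coeff)
  have "hinner k f g = complex_of_real (embed k f \<bullet> embed k g) + \<i> * complex_of_real (embed k f \<bullet> z)"
    unfolding hinner_def summand
    by (intro infsumI has_sum_add has_sum_cmult_right has_sum_of_real)
      (use has_sum_inner_ell2[of "embed k f" "embed k g"] has_sum_inner_ell2[of "embed k f" z] z in simp_all)
  then show ?thesis by simp
qed

lemma hspace_scale: "f \<in> hspace k \<Longrightarrow> (\<lambda>\<alpha>. c * f \<alpha>) \<in> hspace k"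
  using square_summable_scale[of "\<lambda>\<alpha>. f \<alpha> / complex_of_real (sqrt (hweight k \<alpha>))" c]
  by (simp add: hspace_iff_square_summable)

lemma hinner_scale_left: "hinner k (\<lambda>\<alpha>. c * f \<alpha>) g = c * hinner k f g"
  unfolding hinner_def by (simp flip: infsum_cmult_right' add: mult.assoc)

lemma wick_scale_right: "h \<lozenge> (\<lambda>\<alpha>. c * u \<alpha>) = (\<lambda>\<alpha>. c * (h \<lozenge> u) \<alpha>)"
  unfolding wick_def sum_distrib_left by (auto intro!: sum.cong)

text \<open>
  The inner product of \<open>l\<^sup>2\<close> above is only the real part of \<^term>\<open>hinner\<close>, so the real adjoint has to
  be identified with the complex one.
\<close>

lemma hadjoint_wick:
  assumes a: "abs_summable (kernel k h)" and g: "g \<in> hspace k"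
  shows "hadjoint k (\<lambda>u. h \<lozenge> u) g = unembed k (correlate (kernel k h) (embed k g))"
    (is "_ = ?v")
  unfolding hadjoint_def
proof (rule the_equality)
  have Re: "Re (hinner k (h \<lozenge> u) g) = Re (hinner k u ?v)" if "u \<in> hspace k" for u
    using that by (simp add: Re_hinner wick_in_hspace_embed a g unembed_in_hspace embed_unembed
        convolve_adjoint)
  \<comment> \<open>Complex linearity recovers the imaginary parts: they are the real parts at \<open>\<i> u\<close>.\<close>
  have "hinner k (h \<lozenge> u) g = hinner k u ?v" if "u \<in> hspace k" for u
    using Re[OF that] Re[OF hspace_scale[OF that, of \<i>]]
    by (simp add: complex_eq_iff wick_scale_right hinner_scale_left)
  then show "?v \<in> hspace k \<and> (\<forall>u\<in>hspace k. hinner k (h \<lozenge> u) g = hinner k u ?v)"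
    by (simp add: unembed_in_hspace)
next
  fix v assume v: "v \<in> hspace k \<and> (\<forall>u\<in>hspace k. hinner k (h \<lozenge> u) g = hinner k u v)"
  have "x \<bullet> embed k v = x \<bullet> correlate (kernel k h) (embed k g)" for x
  proof -
    have "x \<bullet> embed k v = Re (hinner k (unembed k x) v)"
      using v by (simp add: Re_hinner unembed_in_hspace embed_unembed)
    also have "\<dots> = Re (hinner k (h \<lozenge> unembed k x) g)" using v by (simp add: unembed_in_hspace)
    also have "\<dots> = x \<bullet> correlate (kernel k h) (embed k g)"
      by (simp add: Re_hinner wick_in_hspace_embed a g unembed_in_hspace embed_unembed convolve_adjoint)
    finally show ?thesis .
  qed
  then have "embed k v = correlate (kernel k h) (embed k g)" by (metis vector_eq_ldot)
  then show "v = ?v" using v by (intro embed_inject[of _ k]) (auto simp: unembed_in_hspace embed_unembed)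
qed

section \<open>Riemann integrals in the weighted spaces\<close>

lemma riemann_sums_converge:
  fixes F :: "real \<Rightarrow> 'a::banach"
  assumes F: "continuous_on UNIV F" and "\<epsilon> > 0"
  shows "\<exists>\<delta>>0. \<forall>p. p tagged_division_of {a..b} \<and> (\<lambda>s. ball s \<delta>) fine p \<longrightarrow>
    norm ((\<Sum>(s, K)\<in>p. measure lborel K *\<^sub>R F s) - integral {a..b} F) < \<epsilon>"
proof -
  define \<eta> where "\<eta> = \<epsilon> / (measure lborel {a..b} + 1)"
  have \<eta>: "\<eta> > 0" "\<eta> * measure lborel {a..b} < \<epsilon>"
  proof -
    have "measure lborel {a..b} + 1 > 0" by (simp add: add_nonneg_pos)
    then show "\<eta> > 0" "\<eta> * measure lborel {a..b} < \<epsilon>"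
      using \<open>\<epsilon> > 0\<close> by (simp_all add: \<eta>_def pos_divide_less_eq)
  qed
  have "uniformly_continuous_on {a..b} F"
    using F by (intro compact_uniformly_continuous) (auto intro: continuous_on_subset)
  then obtain \<delta> where "\<delta> > 0"
    and \<delta>: "\<And>s s'. s \<in> {a..b} \<Longrightarrow> s' \<in> {a..b} \<Longrightarrow> dist s' s < \<delta> \<Longrightarrow> dist (F s') (F s) < \<eta>"
    unfolding uniformly_continuous_on_def using \<eta>(1) by metis
  have "norm ((\<Sum>(s, K)\<in>p. measure lborel K *\<^sub>R F s) - integral {a..b} F) < \<epsilon>"
    if p: "p tagged_division_of {a..b}" and fine: "(\<lambda>s. ball s \<delta>) fine p" for p
  proof -
    have p': "p tagged_division_of cbox a b" using p by simp
    have "integral (cbox a b) F = (\<Sum>(s, K)\<in>p. integral K F)"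
      by (rule integral_combine_tagged_division_topdown[OF _ p'])
        (simp add: continuous_integrable[OF F])
    then have "(\<Sum>(s, K)\<in>p. measure lborel K *\<^sub>R F s) - integral {a..b} F
        = (\<Sum>(s, K)\<in>p. measure lborel K *\<^sub>R F s - integral K F)"
      by (simp add: case_prod_beta sum_subtractf)
    also have "norm \<dots> \<le> (\<Sum>(s, K)\<in>p. \<eta> * measure lborel K)"
    proof (rule sum_norm_le, clarify)
      fix s K assume sK: "(s, K) \<in> p"
      obtain c d where K: "K = {c..d}" using tagged_division_ofD(4)[OF p' sK] by auto
      have s: "s \<in> K" and Kab: "K \<subseteq> {a..b}" using tagged_division_ofD(2,3)[OF p' sK] by auto
      then have cd: "c \<le> d" using K by auto
      have "measure lborel K *\<^sub>R F s - integral K F = integral {c..d} (\<lambda>x. F s - F x)"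
        unfolding K using cd
        by (subst Henstock_Kurzweil_Integration.integral_diff)
          (auto intro: continuous_integrable[OF F])
      moreover have "norm (integral {c..d} (\<lambda>x. F s - F x)) \<le> \<eta> * (d - c)"
      proof (rule integral_bound[OF cd])
        show "continuous_on {c..d} (\<lambda>x. F s - F x)"
          by (intro continuous_intros continuous_on_subset[OF F]) auto
        fix x assume "x \<in> {c..d}"
        then have "x \<in> K" using K by simp
        moreover have "K \<subseteq> ball s \<delta>" using fineD[OF fine sK] .
        ultimately have "dist (F x) (F s) < \<eta>"
          using s Kab by (intro \<delta>) (auto simp: dist_commute)
        then show "norm (F s - F x) \<le> \<eta>" by (simp add: dist_norm norm_minus_commute)
      qed
      ultimately show "norm (measure lborel K *\<^sub>R F s - integral K F) \<le> \<eta> * measure lborel K"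
        using cd K by simp
    qed
    also have "\<dots> = \<eta> * measure lborel {a..b}"
      using additive_content_tagged_division[OF p']
      by (simp add: case_prod_beta flip: sum_distrib_left)
    finally show ?thesis using \<eta>(2) by simp
  qed
  with \<open>\<delta> > 0\<close> show ?thesis by blast
qed

text \<open>
  A continuous function needs no point-dependent gauge: uniform continuity gives one mesh size for
  all tags, so the Riemann integral agrees with the Henstock--Kurzweil integral in \<open>l\<^sup>2\<close>.
\<close>

lemma has_hintegral_iff:
  assumes f: "\<And>s. f s \<in> hspace k" and F: "continuous_on UNIV (\<lambda>s. embed k (f s))"
  shows "has_hintegral k f a b I \<longleftrightarrow>
    I \<in> hspace k \<and> embed k I = integral {a..b} (\<lambda>s. embed k (f s))"
proof (cases "I \<in> hspace k")
  case True
  let ?J = "integral {a..b} (\<lambda>s. embed k (f s))"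
  let ?sum = "\<lambda>p. \<Sum>(s, K)\<in>p. measure lborel K *\<^sub>R embed k (f s)"
  have norm_sum: "hnorm k ((\<lambda>\<alpha>. \<Sum>(s, K)\<in>p. complex_of_real (measure lborel K) * f s \<alpha>) - I)
      = norm (?sum p - embed k I)" for p
    using hspace_real_combination[of p "\<lambda>x. f (fst x)" k "\<lambda>x. measure lborel (snd x)"] f True
    by (simp add: hnorm_eq_norm_embed hspace_diff embed_diff case_prod_beta)
  have "embed k I = ?J" if hI: "has_hintegral k f a b I"
  proof -
    have "norm (embed k I - ?J) \<le> \<epsilon>" if "\<epsilon> > 0" for \<epsilon>
    proof -
      from hI \<open>\<epsilon> > 0\<close> obtain \<delta>1 where d1: "\<delta>1 > 0" "\<And>p. p tagged_division_of {a..b} \<Longrightarrow>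
          (\<lambda>s. ball s \<delta>1) fine p \<Longrightarrow> norm (?sum p - embed k I) < \<epsilon> / 2"
        unfolding has_hintegral_def norm_sum by (metis half_gt_zero)
      obtain \<delta>2 where d2: "\<delta>2 > 0" "\<And>p. p tagged_division_of {a..b} \<Longrightarrow>
          (\<lambda>s. ball s \<delta>2) fine p \<Longrightarrow> norm (?sum p - ?J) < \<epsilon> / 2"
        using riemann_sums_converge[OF F, of "\<epsilon> / 2" a b] \<open>\<epsilon> > 0\<close> by auto
      have "gauge (\<lambda>s. ball s (min \<delta>1 \<delta>2))" using d1 d2 by (simp add: gauge_def)
      then obtain p where p: "p tagged_division_of {a..b}" "(\<lambda>s. ball s (min \<delta>1 \<delta>2)) fine p"
        using fine_division_exists_real by blast
      then have "(\<lambda>s. ball s \<delta>1) fine p" "(\<lambda>s. ball s \<delta>2) fine p"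
        by (auto simp: fine_def ball_min_Int)
      then have "norm (?sum p - embed k I) < \<epsilon> / 2" "norm (?sum p - ?J) < \<epsilon> / 2"
        using d1(2) d2(2) p(1) by blast+
      moreover have "norm (embed k I - ?J) \<le> norm (?sum p - ?J) + norm (?sum p - embed k I)"
        using norm_triangle_ineq4[of "?sum p - ?J" "?sum p - embed k I"] by simp
      ultimately show ?thesis by linarith
    qed
    then have "norm (embed k I - ?J) \<le> 0" by (metis add_0 field_le_epsilon)
    then show ?thesis by simp
  qed
  moreover have "has_hintegral k f a b I" if "embed k I = ?J"
    unfolding has_hintegral_def norm_sum that
    using True f riemann_sums_converge[OF F] by auto
  ultimately show ?thesis using True by blast
qed (simp add: has_hintegral_def)

lemma has_hintegral_line_iff:
  assumes f: "\<And>s. f s \<in> hspace k" and F: "continuous_on UNIV (\<lambda>s. embed k (f s))"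
  shows "has_hintegral_line k f I \<longleftrightarrow>
    I \<in> hspace k \<and> has_improper_integral (\<lambda>s. embed k (f s)) (embed k I)"
proof (cases "I \<in> hspace k")
  case True
  let ?J = "\<lambda>a b. integral {a..b} (\<lambda>s. embed k (f s))"
  have "((\<lambda>(a, b). hnorm k (J a b - I)) \<longlongrightarrow> 0) (at_bot \<times>\<^sub>F at_top) \<longleftrightarrow>
      has_improper_integral (\<lambda>s. embed k (f s)) (embed k I)"
    if J: "\<And>a b. a \<le> b \<Longrightarrow> J a b \<in> hspace k \<and> embed k (J a b) = ?J a b" for J
  proof -
    have "((\<lambda>(a, b). hnorm k (J a b - I)) \<longlongrightarrow> 0) (at_bot \<times>\<^sub>F at_top) \<longleftrightarrow>
        ((\<lambda>x. norm ((case x of (a, b) \<Rightarrow> ?J a b) - embed k I)) \<longlongrightarrow> 0) (at_bot \<times>\<^sub>F at_top)"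
    proof (rule filterlim_cong[OF refl refl])
      show "\<forall>\<^sub>F x in at_bot \<times>\<^sub>F at_top. (case x of (a, b) \<Rightarrow> hnorm k (J a b - I))
          = norm ((case x of (a, b) \<Rightarrow> ?J a b) - embed k I)"
        using eventually_bot_top_around[of 0]
      proof eventually_elim
        case (elim x)
        then show ?case
          using J[of "fst x" "snd x"] True
          by (auto simp: case_prod_beta hnorm_eq_norm_embed hspace_diff embed_diff)
      qed
    qed
    then show ?thesis
      by (simp add: has_improper_integral_def tendsto_norm_zero_iff LIM_zero_iff)
  qed
  note line = this
  have exists: "\<exists>J. \<forall>a b. a \<le> b \<longrightarrow> J a b \<in> hspace k \<and> embed k (J a b) = ?J a b"
    by (rule exI[of _ "\<lambda>a b. unembed k (?J a b)"]) (simp add: unembed_in_hspace embed_unembed)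
  show ?thesis
    unfolding has_hintegral_line_def has_hintegral_iff[OF f F]
    using True line exists by blast
qed (simp add: has_hintegral_line_def)

lemma has_improper_integral_unique:
  "has_improper_integral F x \<Longrightarrow> has_improper_integral F y \<Longrightarrow> x = y"
  unfolding has_improper_integral_def by (rule tendsto_unique[OF at_bot_prod_at_top_neq_bot])

lemma hintegral_line_eq:
  assumes f: "\<And>s. f s \<in> hspace k" and F: "continuous_on UNIV (\<lambda>s. embed k (f s))"
    and y: "has_improper_integral (\<lambda>s. embed k (f s)) y"
  shows "hintegrable_line k f" and "hintegral_line k f = unembed k y"
proof -
  have I: "has_hintegral_line k f (unembed k y)"
    using y by (simp add: has_hintegral_line_iff[OF f F] unembed_in_hspace embed_unembed)
  then show "hintegrable_line k f" by (auto simp: hintegrable_line_def)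
  show "hintegral_line k f = unembed k y"
    unfolding hintegral_line_def
  proof (rule the_equality, rule I)
    fix I assume "has_hintegral_line k f I"
    then have "I \<in> hspace k" "embed k I = y"
      using has_improper_integral_unique[OF _ y] by (auto simp: has_hintegral_line_iff[OF f F])
    then show "I = unembed k y"
      by (intro embed_inject[of _ k]) (auto simp: unembed_in_hspace embed_unembed)
  qed
qed

section \<open>The equivalence\<close>

lemma kernel_tendsto:
  assumes kl: "k > l + 1" and h: "hcontinuous l h"
  shows "((\<lambda>s. l1_norm (\<lambda>\<beta>. kernel k (h s) \<beta> - kernel k (h t) \<beta>)) \<longlongrightarrow> 0) (at t)"
proof -
  obtain C where C: "\<And>f. f \<in> hspace l \<Longrightarrow> l1_norm (kernel k f) \<le> C * hnorm l f"
    using kernel_l1_norm_le[OF kl] by blast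
  have "(\<lambda>\<beta>. kernel k (h s) \<beta> - kernel k (h t) \<beta>) = kernel k (h s - h t)" for s
    by (auto simp: kernel_def diff_divide_distrib)
  moreover have "((\<lambda>s. l1_norm (kernel k (h s - h t))) \<longlongrightarrow> 0) (at t)"
  proof (rule Lim_null_comparison[OF always_eventually, OF allI])
    show "norm (l1_norm (kernel k (h s - h t))) \<le> C * hnorm l (h s - h t)" for s
      using C[of "h s - h t"] h by (simp add: l1_norm_nonneg hspace_diff hcontinuous_def)
    show "((\<lambda>s. C * hnorm l (h s - h t)) \<longlongrightarrow> 0) (at t)"
      using h by (auto simp: hcontinuous_def intro: tendsto_mult_right_zero)
  qed
  ultimately show ?thesis by simp
qed

text \<open>
  The condition on \<open>T s (u s)\<close> is the case \<open>t = 0\<close> of the other one for the reflected input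
  \<open>s \<mapsto> u (- s)\<close>; conversely, the output at each \<open>t\<close> is the case of the input \<open>s \<mapsto> u (t - s)\<close>. A
  finite supremum of extended real norms amounts to a real bound \<open>U\<close>.
\<close>

lemma bounded_output_iff_all_inputs:
  fixes T :: "real \<Rightarrow> multi_index ell2 \<Rightarrow> multi_index ell2"
  assumes wick: "\<And>t u. u \<in> hspace k \<Longrightarrow> h t \<lozenge> u \<in> hspace k \<and> embed k (h t \<lozenge> u) = T t (embed k u)"
    and T: "\<And>u. continuous_on UNIV u \<Longrightarrow> continuous_on UNIV (\<lambda>s. T s (u s))"
    and M: "M \<ge> 0"
  shows "(\<forall>u. hcontinuous k u \<and> (SUP t. ennreal (hnorm k (u t))) < \<infinity> \<longrightarrow>
        (\<forall>t. hintegrable_line k (\<lambda>s. h s \<lozenge> u (t - s))) \<and>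
        (SUP t. ennreal (hnorm k (hintegral_line k (\<lambda>s. h s \<lozenge> u (t - s)))))
          \<le> ennreal M * (SUP t. ennreal (hnorm k (u t)))) \<longleftrightarrow>
      (\<forall>u U. continuous_on UNIV u \<and> (\<forall>s. norm (u s) \<le> U) \<longrightarrow>
        (\<exists>y. has_improper_integral (\<lambda>s. T s (u s)) y \<and> norm y \<le> M * U))"
    (is "?series \<longleftrightarrow> ?abstract")
proof
  assume series: ?series
  show ?abstract
  proof (intro allI impI, elim conjE)
    fix u :: "real \<Rightarrow> multi_index ell2" and U
    assume u: "continuous_on UNIV u" and U: "\<forall>s. norm (u s) \<le> U"
    define v where "v t = unembed k (u (- t))" for t
    have v: "v t \<in> hspace k" "embed k (v t) = u (- t)" for t
      by (simp_all add: v_def unembed_in_hspace embed_unembed)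
    have hv: "hcontinuous k v"
      unfolding hcontinuous_iff v(2) using v(1)
      by (auto intro!: continuous_on_compose2[OF u] continuous_intros)
    have sup: "(SUP t. ennreal (hnorm k (v t))) \<le> ennreal U"
      using U by (intro SUP_least) (simp add: hnorm_eq_norm_embed v ennreal_leI)
    then have "(SUP t. ennreal (hnorm k (v t))) < \<infinity>"
      using ennreal_less_top le_less_trans by (metis infinity_ennreal_def)
    with series hv have int: "hintegrable_line k (\<lambda>s. h s \<lozenge> v (0 - s))"
      and le: "(SUP t. ennreal (hnorm k (hintegral_line k (\<lambda>s. h s \<lozenge> v (t - s)))))
          \<le> ennreal M * (SUP t. ennreal (hnorm k (v t)))"
      by blast+
    have f: "h s \<lozenge> v (0 - s) \<in> hspace k" "embed k (h s \<lozenge> v (0 - s)) = T s (u s)" for s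
      using wick[OF v(1)] v(2) by auto
    have F: "continuous_on UNIV (\<lambda>s. embed k (h s \<lozenge> v (0 - s)))"
      unfolding f(2) by (rule T[OF u])
    obtain I where "has_hintegral_line k (\<lambda>s. h s \<lozenge> v (0 - s)) I"
      using int by (auto simp: hintegrable_line_def)
    then have y: "has_improper_integral (\<lambda>s. embed k (h s \<lozenge> v (0 - s))) (embed k I)"
      using has_hintegral_line_iff[OF f(1) F] by blast
    have "U \<ge> 0" using U norm_ge_zero order_trans by blast
    have "ennreal (norm (embed k I)) = ennreal (hnorm k (hintegral_line k (\<lambda>s. h s \<lozenge> v (0 - s))))"
      by (simp only: hintegral_line_eq(2)[OF f(1) F y])
        (simp add: hnorm_eq_norm_embed unembed_in_hspace embed_unembed)
    also have "\<dots> \<le> (SUP t. ennreal (hnorm k (hintegral_line k (\<lambda>s. h s \<lozenge> v (t - s)))))"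
      by (rule SUP_upper) simp
    also have "\<dots> \<le> ennreal M * ennreal U"
      using le sup by (meson mult_left_mono order_trans zero_le)
    also have "\<dots> = ennreal (M * U)" using M \<open>U \<ge> 0\<close> by (simp add: ennreal_mult)
    finally have "norm (embed k I) \<le> M * U" using M \<open>U \<ge> 0\<close> by (simp add: ennreal_le_iff)
    with y show "\<exists>y. has_improper_integral (\<lambda>s. T s (u s)) y \<and> norm y \<le> M * U"
      unfolding f(2) by blast
  qed
next
  assume abstract: ?abstract
  show ?series
  proof (intro allI impI, elim conjE)
    fix u assume u: "hcontinuous k u" and fin: "(SUP t. ennreal (hnorm k (u t))) < \<infinity>"
    have uk: "u t \<in> hspace k" for t using u by (simp add: hcontinuous_iff)
    have uc: "continuous_on UNIV (\<lambda>t. embed k (u t))" using u by (simp add: hcontinuous_iff)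
    obtain U where "U \<ge> 0" and U: "(SUP t. ennreal (hnorm k (u t))) = ennreal U"
      using fin by (cases "SUP t. ennreal (hnorm k (u t))") auto
    have bound: "norm (embed k (u t)) \<le> U" for t
    proof -
      have "ennreal (hnorm k (u t)) \<le> ennreal U" unfolding U[symmetric] by (rule SUP_upper) simp
      then show ?thesis using \<open>U \<ge> 0\<close> by (simp add: hnorm_eq_norm_embed uk)
    qed
    have out: "hintegrable_line k (\<lambda>s. h s \<lozenge> u (t - s)) \<and>
        hnorm k (hintegral_line k (\<lambda>s. h s \<lozenge> u (t - s))) \<le> M * U" for t
    proof -
      have f: "h s \<lozenge> u (t - s) \<in> hspace k" "embed k (h s \<lozenge> u (t - s)) = T s (embed k (u (t - s)))" for s
        using wick[OF uk] by auto
      have c: "continuous_on UNIV (\<lambda>s. embed k (u (t - s)))"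
        by (intro continuous_on_compose2[OF uc] continuous_intros) auto
      then have F: "continuous_on UNIV (\<lambda>s. embed k (h s \<lozenge> u (t - s)))"
        unfolding f(2) by (rule T)
      obtain y where y: "has_improper_integral (\<lambda>s. embed k (h s \<lozenge> u (t - s))) y" "norm y \<le> M * U"
        unfolding f(2) using abstract c bound by blast
      show ?thesis
        using hintegral_line_eq[OF f(1) F y(1)] y(2)
        by (simp add: hnorm_eq_norm_embed unembed_in_hspace embed_unembed)
    qed
    then have "(SUP t. ennreal (hnorm k (hintegral_line k (\<lambda>s. h s \<lozenge> u (t - s))))) \<le> ennreal (M * U)"
      by (intro SUP_least ennreal_leI) simp
    with out show "(\<forall>t. hintegrable_line k (\<lambda>s. h s \<lozenge> u (t - s))) \<and>
        (SUP t. ennreal (hnorm k (hintegral_line k (\<lambda>s. h s \<lozenge> u (t - s)))))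
          \<le> ennreal M * (SUP t. ennreal (hnorm k (u t)))"
      using M \<open>U \<ge> 0\<close> by (simp add: U ennreal_mult)
  qed
qed

theorem theorem7p3:
  fixes k l :: nat and h :: "real \<Rightarrow> hseries" and M :: real
  assumes "l \<ge> 1" and "k > l + 1"
    and "hcontinuous l h"
    and "M > 0"
  shows
    "(\<forall>u. hcontinuous k u \<and> (SUP t. ennreal (hnorm k (u t))) < \<infinity> \<longrightarrow>
        (\<forall>t. hintegrable_line k (\<lambda>s. h s \<lozenge> u (t - s))) \<and>
        (SUP t. ennreal (hnorm k (hintegral_line k (\<lambda>s. h s \<lozenge> u (t - s)))))
          \<le> ennreal M * (SUP t. ennreal (hnorm k (u t))))
     \<longleftrightarrow>
     (\<forall>g\<in>hspace k. hnorm k g \<le> 1 \<longrightarrow>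
        (\<integral>\<^sup>+t. ennreal (hnorm k (hadjoint k (\<lambda>u. h t \<lozenge> u) g)) \<partial>lborel) \<le> ennreal M)"
proof -
  let ?a = "\<lambda>t. kernel k (h t)"
  have a: "abs_summable (?a t)" for t
    using kernel_l1_norm_le[OF assms(2)] assms(3) by (auto simp: hcontinuous_def)
  note lim = kernel_tendsto[OF assms(2,3)]
  have T: "continuous_on UNIV (\<lambda>s. convolve (?a s) (u s))" if "continuous_on UNIV u" for u
    by (rule continuous_on_convolve[OF a lim that])
  have "(\<forall>g\<in>hspace k. hnorm k g \<le> 1 \<longrightarrow>
        (\<integral>\<^sup>+t. ennreal (hnorm k (hadjoint k (\<lambda>u. h t \<lozenge> u) g)) \<partial>lborel) \<le> ennreal M) \<longleftrightarrow>
      (\<forall>x. norm x \<le> 1 \<longrightarrow> (\<integral>\<^sup>+t. ennreal (norm (correlate (?a t) x)) \<partial>lborel) \<le> ennreal M)"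
    (is "?series \<longleftrightarrow> ?abstract")
  proof -
    have eq: "hnorm k (hadjoint k (\<lambda>u. h t \<lozenge> u) g) = norm (correlate (?a t) (embed k g))"
      if "g \<in> hspace k" for t g
      by (simp add: hadjoint_wick[OF a that] hnorm_eq_norm_embed unembed_in_hspace embed_unembed)
    show ?thesis
    proof
      assume ?abstract
      then show ?series by (simp add: eq hnorm_eq_norm_embed)
    next
      assume series: ?series
      show ?abstract
      proof (intro allI impI)
        fix x :: "multi_index ell2" assume "norm x \<le> 1"
        then show "(\<integral>\<^sup>+t. ennreal (norm (correlate (?a t) x)) \<partial>lborel) \<le> ennreal M"
          using series[rule_format, of "unembed k x"]
          by (simp add: eq unembed_in_hspace embed_unembed hnorm_eq_norm_embed)
      qed
    qed
  qed
  also have "\<dots> \<longleftrightarrow> (\<forall>u U. continuous_on UNIV u \<and> (\<forall>s. norm (u s) \<le> U) \<longrightarrow>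
      (\<exists>y. has_improper_integral (\<lambda>s. convolve (?a s) (u s)) y \<and> norm y \<le> M * U))"
    by (rule bounded_output_iff_adjoint_integrable[symmetric])
      (use assms(4) in \<open>auto intro: convolve_adjoint a T continuous_on_correlate lim\<close>)
  finally show ?thesis
    using bounded_output_iff_all_inputs[of k h "\<lambda>t. convolve (?a t)" M] T assms(4)
    by (simp add: wick_in_hspace_embed a)
qed

end
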